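(* Let $n\in\mathbb N_0$, $\beta,\gamma\in(-1,1)\setminus\{0\}$, $0<|q|<1$, $|t|<1-\beta^2$. Then, with $x=\cos\theta$, $$\int_{-1}^1\frac1{(te^{i\theta};q)_\infty}\;{}_2\phi_1\!\left(\beta,\beta e^{2i\theta};\beta^2;q,te^{-i\theta}\right)C_n(x;\gamma|q)\frac{w(x;\gamma|q)}{\sqrt{1-x^2}}\,dx$$ $$=2\pi t^n\frac{(\gamma,q\gamma;q)_\infty(\beta,\gamma^2;q)_n}{(\gamma^2,q;q)_\infty(q,\beta^2,q\gamma;q)_n}\;{}_6\phi_5\!\left(\beta\gamma^{-1},\beta q^n,0,0,0,0;\ \gamma q^{n+1},\pm\beta q^{n/2},\pm\beta q^{(n+1)/2};\ q,\gamma t^2\right).$$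
   Context: Notation: $\mathbb N_0=\{0,1,2,\dots\}$, $(a;q)_0=1$, $(a;q)_n=\prod_{j=0}^{n-1}(1-aq^j)$, $(a;q)_\infty=\prod_{j\ge0}(1-aq^j)$, $(a_1,\dots,a_r;q)_n=\prod_i(a_i;q)_n$ (also for $n=\infty$). In a list of parameters, $\pm a$ stands for the two entries $a,-a$. The basic hypergeometric series, with upper parameters listed before the first semicolon and lower parameters before the second, is $${}_r\phi_s(a_1,\dots,a_r;b_1,\dots,b_s;q,z)=\sum_{k=0}^\infty\frac{(a_1,\dots,a_r;q)_k}{(q,b_1,\dots,b_s;q)_k}\left((-1)^kq^{\binom k2}\right)^{1+s-r}z^k.$$ The continuous $q$-ultraspherical/Rogers polynomials are, for $x=\cos\theta$, $$C_n(x;\beta|q)=\frac{(\beta;q)_n}{(q;q)_n}e^{in\theta}\,{}_2\phi_1\!\left(q^{-n},\beta;\beta^{-1}q^{1-n};q,q\beta^{-1}e^{-2i\theta}\right),$$ and the weight function $w$ on $(-1,1)$ is $$w(x;\beta|q)=\left|\frac{(e^{2i\theta};q)_\infty}{(\beta e^{2i\theta};q)_\infty}\right|^2.$$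
   Formalization: The base q is taken to be real with 0<|q|<1 (negative q allowed); for non-real q the identity fails, e.g. for n=0, t=0, q=i/2 and small γ the left side is real and the right side is not. *)

theory Defs
  imports "HOL-Analysis.Analysis"
begin

definition qpoch :: "complex list \<Rightarrow> complex \<Rightarrow> nat \<Rightarrow> complex" where
  "qpoch as q n = (\<Prod>a\<leftarrow>as. \<Prod>j<n. 1 - a * q ^ j)"

definition qpoch_inf :: "complex list \<Rightarrow> complex \<Rightarrow> complex" where
  "qpoch_inf as q = (\<Prod>a\<leftarrow>as. \<Prod>j. 1 - a * q ^ j)"

text \<open>The series \<open>\<^sub>r\<phi>\<^sub>s\<close>, where \<open>r\<close> and \<open>s\<close> are the lengths of the two parameter lists; the exponent
  \<open>1 + s - r\<close> may be negative. If \<open>q \<noteq> 0\<close> and some upper parameter is \<open>q\<^bsup>-n\<^esup>\<close>, all terms with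
  \<open>k > n\<close> vanish, also those whose denominator is \<open>0\<close>, since \<open>0 / 0 = 0\<close>.\<close>

definition qhyp :: "complex list \<Rightarrow> complex list \<Rightarrow> complex \<Rightarrow> complex \<Rightarrow> complex" where
  "qhyp as bs q z =
     (\<Sum>k. qpoch as q k / qpoch (q # bs) q k *
       ((-1) ^ k * q ^ (k choose 2)) powi (1 + int (length bs) - int (length as)) * z ^ k)"

text \<open>Below, \<open>x = cos \<theta>\<close> with \<open>\<theta> = arccos x\<close>, and \<open>cis \<theta>\<close> is \<open>exp (\<i> * \<theta>)\<close>.\<close>

definition rogers_poly :: "nat \<Rightarrow> real \<Rightarrow> real \<Rightarrow> real \<Rightarrow> complex" where
  "rogers_poly n \<beta> q x =
     (let \<theta> = arccos x; b = complex_of_real \<beta>; p = complex_of_real q in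
       qpoch [b] p n / qpoch [p] p n * cis (real n * \<theta>) *
       qhyp [p powi (- int n), b] [inverse b * p powi (1 - int n)] p
         (p * inverse b * cis (- 2 * \<theta>)))"

definition rogers_weight :: "real \<Rightarrow> real \<Rightarrow> real \<Rightarrow> real" where
  "rogers_weight \<beta> q x =
     (let \<theta> = arccos x; b = complex_of_real \<beta>; p = complex_of_real q in
       (cmod (qpoch_inf [cis (2 * \<theta>)] p / qpoch_inf [b * cis (2 * \<theta>)] p))\<^sup>2)"

end

theory Submission
  imports Defs
begin

text \<open>
  Put \<open>z = e\<^sup>i\<^sup>\<theta>\<close> and \<open>u = z\<^sup>2\<close>. The factor in front of \<open>C\<^sub>n(x; \<gamma>|q)\<close> is the generating function
  \<open>\<Sum>m. C\<^sub>m(x; \<beta>|q) t\<^sup>m / (\<beta>\<^sup>2; q)\<^sub>m\<close> (\<open>rogers_gen_sums\<close>), and this series converges uniformly on the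
  circle. So the integral is the sum over \<open>m\<close> of \<open>t\<^sup>m / (\<beta>\<^sup>2; q)\<^sub>m\<close> times the mixed moment
  \<open>\<integral> C\<^sub>m(x; \<beta>|q) C\<^sub>n(x; \<gamma>|q) w(x; \<gamma>|q) / sqrt (1 - x\<^sup>2) dx\<close>. The mixed moment has a closed form and
  vanishes unless \<open>m = n + 2 k\<close> with \<open>k \<ge> 0\<close> (\<open>mixed_moment_eq\<close>); this one formula contains both the
  orthogonality of the Rogers polynomials and the coefficients in Rogers' connection formula between
  the parameters \<open>\<beta>\<close> and \<open>\<gamma>\<close>. Splitting \<open>(\<beta>; q)\<^sub>n\<^sub>+\<^sub>k\<close>, \<open>(q \<gamma>; q)\<^sub>n\<^sub>+\<^sub>k\<close> and
  \<open>(\<beta>\<^sup>2; q)\<^sub>n\<^sub>+\<^sub>2\<^sub>k\<close> at \<open>n\<close> turns the sum over \<open>k\<close> into the \<open>\<^sub>6\<phi>\<^sub>5\<close>; the four parameters with signs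
  come from \<open>(\<beta>\<^sup>2 q\<^sup>n; q)\<^sub>2\<^sub>k\<close>.

  The mixed moments are found by induction on \<open>m\<close>. Multiplication by \<open>2 x = z + 1/z\<close> acts on each of the
  families \<open>C\<^sub>m(x; \<beta>|q)\<close> and \<open>C\<^sub>n(x; \<gamma>|q)\<close> by a three-term recurrence; letting it act on either factor
  of the integrand expresses the moments with index \<open>m + 2\<close> by those with \<open>m + 1\<close> and \<open>m\<close>, and the
  closed form satisfies the same relation. What remains is \<open>m = 0\<close>: the mean value of
  \<open>C\<^sub>n(x; \<gamma>|q)\<close> against the weight is \<open>0\<close> for \<open>n \<ge> 1\<close> (\<open>weight_int_rogers\<close>), and for \<open>n = 0\<close> it is the
  total mass of the weight.

  Both facts are read off from Fourier coefficients. By the q-binomial theorem the weight is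
  \<open>R(u) R(1/u)\<close> with an absolutely convergent power series \<open>R(u) = (u; q)\<^sub>\<infinity> / (\<gamma> u; q)\<^sub>\<infinity>\<close>. The Laurent
  coefficients of \<open>w / (1 - u)\<close> satisfy a first-order recurrence (\<open>hcoef_Suc\<close>, a case of Ramanujan's
  \<open>\<^sub>1\<psi>\<^sub>1\<close> sum), and its constant term is a q-Gauss sum (\<open>hcoef_0_eq\<close>), which supplies the infinite
  products on the right-hand side. Given the recurrence, the finite sum for the mean value of
  \<open>C\<^sub>n(x; \<gamma>|q)\<close> telescopes.

  The recurrences for the polynomials and for the coefficients of the generating function are both
  obtained from linear q-difference equations of formal power series: a hypergeometric coefficient
  sequence gives an equation between \<open>F(X)\<close>, \<open>F(q X)\<close> and possibly \<open>F(q\<^sup>2 X)\<close>, and such equations can be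
  multiplied.
\<close>

section \<open>Shifted factorials and the q-binomial theorem\<close>

locale q_base =
  fixes q :: complex
  assumes norm_q: "norm q < 1"
begin

definition qfac :: "complex \<Rightarrow> nat \<Rightarrow> complex" where
  "qfac a n = (\<Prod>j<n. 1 - a * q ^ j)"

text \<open>For \<open>x \<noteq> 0\<close> this is \<open>x\<^sup>k (a/x; q)\<^sub>k / (q; q)\<^sub>k\<close>. The homogeneous form avoids the division, so that the
  value \<open>x = 0\<close> and parameters such as \<open>1/\<gamma>\<close> need no separate treatment.\<close>

definition qbin :: "complex \<Rightarrow> complex \<Rightarrow> nat \<Rightarrow> complex" where
  "qbin x a k = (\<Prod>j<k. x - a * q ^ j) / qfac q k"

lemma qfac_0 [simp]: "qfac a 0 = 1"
  and qfac_Suc: "qfac a (Suc n) = qfac a n * (1 - a * q ^ n)"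
  by (simp_all add: qfac_def)

lemma one_minus_nonzero: "1 - a * q ^ j \<noteq> 0" if "norm a < 1"
proof -
  have "norm (a * q ^ j) \<le> norm a * 1"
    unfolding norm_mult norm_power using norm_q by (intro mult_left_mono power_le_one) auto
  then show ?thesis using that by auto
qed

lemma one_minus_power_nonzero: "1 - q ^ Suc j \<noteq> 0"
  using one_minus_nonzero[OF norm_q] by (metis power_Suc)

lemma qfac_nonzero: "norm a < 1 \<Longrightarrow> qfac a n \<noteq> 0"
  unfolding qfac_def prod_zero_iff[OF finite_lessThan] using one_minus_nonzero by blast

lemma convergent_prod_qfac: "convergent_prod (\<lambda>j. 1 - a * q ^ j)"
proof -
  have "summable (\<lambda>j. norm a * norm q ^ j)"
    using norm_q by (intro summable_mult summable_geometric) auto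
  then have "summable (\<lambda>j. norm ((1 - a * q ^ j) - 1))"
    by (simp add: norm_mult norm_power)
  then show ?thesis
    by (intro abs_convergent_prod_imp_convergent_prod summable_imp_abs_convergent_prod)
qed

lemma qfac_tendsto: "qfac a \<longlonglongrightarrow> (\<Prod>j. 1 - a * q ^ j)"
proof -
  have "(\<lambda>n. qfac a (Suc n)) \<longlonglongrightarrow> (\<Prod>j. 1 - a * q ^ j)"
    using convergent_prod_LIMSEQ[OF convergent_prod_qfac, of a]
    by (simp add: qfac_def lessThan_Suc_atMost)
  then show ?thesis by (subst (asm) filterlim_sequentially_Suc)
qed

lemma qfac_inf_nonzero: "norm a < 1 \<Longrightarrow> (\<Prod>j. 1 - a * q ^ j) \<noteq> 0"
  by (intro prodinf_nonzero convergent_prod_qfac one_minus_nonzero)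

text \<open>The bound depends on \<open>a\<close> only through its modulus; this gives bounds that are uniform when
  \<open>a\<close> runs through a circle.\<close>

lemma norm_qfac_le: "norm (qfac a n) \<le> exp (norm a / (1 - norm q))"
proof -
  have "norm (qfac a n) = (\<Prod>j<n. norm (1 - a * q ^ j))"
    by (simp add: qfac_def prod_norm)
  also have "\<dots> \<le> (\<Prod>j<n. exp (norm a * norm q ^ j))"
  proof (intro prod_mono conjI norm_ge_zero)
    fix j
    have "norm (1 - a * q ^ j) \<le> 1 + norm a * norm q ^ j"
      by (rule norm_triangle_le_diff) (simp add: norm_mult norm_power)
    also have "\<dots> \<le> exp (norm a * norm q ^ j)" by (rule exp_ge_add_one_self)
    finally show "norm (1 - a * q ^ j) \<le> exp (norm a * norm q ^ j)" .
  qed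
  also have "\<dots> = exp (norm a * (\<Sum>j<n. norm q ^ j))"
    by (simp add: exp_sum sum_distrib_left)
  finally have 1: "norm (qfac a n) \<le> exp (norm a * (\<Sum>j<n. norm q ^ j))" .
  have "(\<Sum>j<n. norm q ^ j) \<le> (\<Sum>j. norm q ^ j)"
    using norm_q by (intro sum_le_suminf summable_geometric) auto
  also have "(\<Sum>j. norm q ^ j) = 1 / (1 - norm q)"
    using norm_q by (simp add: suminf_geometric)
  finally have "norm a * (\<Sum>j<n. norm q ^ j) \<le> norm a * (1 / (1 - norm q))"
    by (rule mult_left_mono) simp
  then have "exp (norm a * (\<Sum>j<n. norm q ^ j)) \<le> exp (norm a / (1 - norm q))"
    by simp
  with 1 show ?thesis by (rule order_trans)
qed

lemma inverse_qfac_bounded: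
  assumes "norm a < 1"
  obtains K where "K > 0" "\<And>n. norm (inverse (qfac a n)) \<le> K"
proof -
  have "(\<lambda>n. inverse (qfac a n)) \<longlonglongrightarrow> inverse (\<Prod>j. 1 - a * q ^ j)"
    by (intro tendsto_inverse qfac_tendsto qfac_inf_nonzero assms)
  from convergent_imp_Bseq[OF convergentI[OF this]] show ?thesis
    using that by (auto elim!: BseqE)
qed

lemma qbin_0 [simp]: "qbin x a 0 = 1"
  by (simp add: qbin_def)

lemma qbin_Suc: "(1 - q ^ Suc k) * qbin x a (Suc k) = (x - a * q ^ k) * qbin x a k"
  using one_minus_power_nonzero[of k] qfac_nonzero[OF norm_q, of k]
  by (simp add: qbin_def qfac_Suc field_simps)

lemma qbin_one: "qbin 1 a k = qfac a k / qfac q k"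
  by (simp add: qbin_def qfac_def)

lemma qbin_one_0: "qbin 1 0 k = 1 / qfac q k"
  by (simp add: qbin_def)

lemma power_q_tendsto_0: "(\<lambda>n. q ^ n) \<longlonglongrightarrow> 0"
  using norm_q by (rule LIMSEQ_power_zero)

lemma qbin_summable:
  assumes "norm (x * u) < 1"
  shows "summable (\<lambda>k. norm (qbin x a k * u ^ k))"
proof -
  obtain c where c: "norm (x * u) < c" "c < 1" using assms dense by blast
  define \<rho> where "\<rho> k = (x * u - a * u * q ^ k) / (1 - q * q ^ k)" for k
  have "\<rho> \<longlonglongrightarrow> (x * u - a * u * 0) / (1 - q * 0)"
    unfolding \<rho>_def by (intro tendsto_intros power_q_tendsto_0) auto
  then have "(\<lambda>k. norm (\<rho> k)) \<longlonglongrightarrow> norm (x * u)"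
    by (auto dest: tendsto_norm)
  then have "eventually (\<lambda>k. norm (\<rho> k) < c) sequentially"
    using c(1) by (rule order_tendstoD(2))
  then obtain N where N: "\<And>k. k \<ge> N \<Longrightarrow> norm (\<rho> k) < c"
    by (auto simp: eventually_sequentially)
  have step: "qbin x a (Suc k) * u ^ Suc k = \<rho> k * (qbin x a k * u ^ k)" for k
  proof -
    have "qbin x a (Suc k) = (x - a * q ^ k) * qbin x a k / (1 - q * q ^ k)"
      using qbin_Suc[of k x a] one_minus_power_nonzero[of k] by (simp add: field_simps)
    then show ?thesis by (simp add: \<rho>_def field_simps)
  qed
  show ?thesis
  proof (rule summable_ratio_test[OF c(2), of N])
    fix k assume "N \<le> k"
    then show "norm (norm (qbin x a (Suc k) * u ^ Suc k)) \<le> c * norm (norm (qbin x a k * u ^ k))"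
      using N[of k] unfolding step norm_mult[of "\<rho> k"] by (auto intro: mult_right_mono)
  qed
qed

text \<open>The recurrence of the coefficients says \<open>(1 - x u) S(u) = (1 - a u) S(q u)\<close> for the sum \<open>S(u)\<close>.
  Iterating it \<open>N\<close> times leaves the factor \<open>S(q\<^sup>N u)\<close>, which tends to \<open>S(0) = 1\<close>.\<close>

lemma q_binomial_theorem:
  assumes "norm (x * u) < 1"
  shows "(\<lambda>k. qbin x a k * u ^ k) sums ((\<Prod>j. 1 - a * u * q ^ j) / (\<Prod>j. 1 - x * u * q ^ j))"
proof -
  define S where "S v = (\<Sum>k. qbin x a k * u ^ k * v ^ k)" for v
  have sm: "summable (\<lambda>k. qbin x a k * u ^ k)"
    using qbin_summable[OF assms] by (rule summable_norm_cancel)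
  have sm': "summable (\<lambda>k. qbin x a k * u ^ k * v ^ k)" if "norm v \<le> 1" for v
  proof -
    have "norm (x * (u * v)) \<le> norm (x * u) * 1"
      unfolding norm_mult mult.assoc using that by (intro mult_left_mono) auto
    then have "norm (x * (u * v)) < 1" using assms by simp
    from summable_norm_cancel[OF qbin_summable[OF this]] show ?thesis
      by (simp add: power_mult_distrib mult.assoc)
  qed
  have feq: "(1 - x * u * v) * S v = (1 - a * u * v) * S (q * v)" if v: "norm v \<le> 1" for v
  proof -
    let ?c = "\<lambda>k. qbin x a k * u ^ k * v ^ k"
    have qv: "norm (q * v) \<le> 1"
      unfolding norm_mult using v norm_q by (intro mult_le_one) auto
    have 1: "(\<lambda>k. ?c k) sums S v" and 2: "(\<lambda>k. ?c k * q ^ k) sums S (q * v)"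
      using summable_sums[OF sm'[OF v]] summable_sums[OF sm'[OF qv]]
      by (simp_all add: S_def power_mult_distrib mult_ac)
    have "(\<lambda>k. ?c k - ?c k * q ^ k) sums (S v - S (q * v))"
      by (intro sums_diff 1 2)
    then have "(\<lambda>k. ?c (Suc k) - ?c (Suc k) * q ^ Suc k) sums (S v - S (q * v))"
      by (subst (asm) sums_Suc_iff[symmetric, where f="\<lambda>k. ?c k - ?c k * q ^ k" and s="S v - S (q * v)", simplified]) simp
    moreover have "?c (Suc k) - ?c (Suc k) * q ^ Suc k = x * u * v * ?c k - a * u * v * (?c k * q ^ k)" for k
    proof -
      have "?c (Suc k) - ?c (Suc k) * q ^ Suc k = ((1 - q ^ Suc k) * qbin x a (Suc k)) * u ^ Suc k * v ^ Suc k"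
        by (simp add: algebra_simps)
      also have "\<dots> = x * u * v * ?c k - a * u * v * (?c k * q ^ k)"
        unfolding qbin_Suc by (simp add: algebra_simps)
      finally show ?thesis .
    qed
    moreover have "(\<lambda>k. x * u * v * ?c k - a * u * v * (?c k * q ^ k)) sums (x * u * v * S v - a * u * v * S (q * v))"
      by (intro sums_diff sums_mult 1 2)
    ultimately have "S v - S (q * v) = x * u * v * S v - a * u * v * S (q * v)"
      by (auto dest: sums_unique2)
    then show ?thesis by (simp add: algebra_simps)
  qed
  have iter: "qfac (x * u) N * S 1 = qfac (a * u) N * S (q ^ N)" for N
  proof (induction N)
    case (Suc N)
    have "norm (q ^ N) \<le> 1"
      unfolding norm_power using norm_q by (intro power_le_one) auto
    then have *: "(1 - x * u * q ^ N) * S (q ^ N) = (1 - a * u * q ^ N) * S (q ^ Suc N)"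
      using feq[of "q ^ N"] by simp
    have "qfac (x * u) (Suc N) * S 1 = (1 - x * u * q ^ N) * (qfac (x * u) N * S 1)"
      by (simp add: qfac_Suc)
    also have "\<dots> = qfac (a * u) N * ((1 - x * u * q ^ N) * S (q ^ N))"
      unfolding Suc by simp
    also have "\<dots> = qfac (a * u) (Suc N) * S (q ^ Suc N)"
      unfolding * by (simp add: qfac_Suc)
    finally show ?case .
  qed simp
  have "isCont S 0"
    unfolding S_def by (rule isCont_powser[where K=1]) (use sm in auto)
  then have "(\<lambda>N. S (q ^ N)) \<longlonglongrightarrow> S 0"
    using power_q_tendsto_0 by (rule isCont_tendsto_compose)
  moreover have "S 0 = 1"
    unfolding S_def by (subst powser_zero) simp
  ultimately have "(\<lambda>N. qfac (a * u) N * S (q ^ N)) \<longlonglongrightarrow> (\<Prod>j. 1 - a * u * q ^ j) * 1"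
    by (intro tendsto_mult qfac_tendsto) auto
  moreover have "(\<lambda>N. qfac (x * u) N * S 1) \<longlonglongrightarrow> (\<Prod>j. 1 - x * u * q ^ j) * S 1"
    by (intro tendsto_mult qfac_tendsto tendsto_const)
  ultimately have "(\<Prod>j. 1 - x * u * q ^ j) * S 1 = (\<Prod>j. 1 - a * u * q ^ j)"
    unfolding iter by (auto dest: LIMSEQ_unique)
  then have "S 1 = (\<Prod>j. 1 - a * u * q ^ j) / (\<Prod>j. 1 - x * u * q ^ j)"
    using qfac_inf_nonzero[OF assms] by (simp add: field_simps)
  then show ?thesis
    using summable_sums[OF sm] by (simp add: S_def)
qed

end

section \<open>Laurent coefficients of the weight\<close>

locale rogers_parameter = q_base +
  fixes g :: complex
  assumes norm_g: "norm g < 1"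
begin

text \<open>The generating functions of \<open>rcoef\<close> and \<open>pcoef\<close> are \<open>R(u) = (u; q)\<^sub>\<infinity> / (g u; q)\<^sub>\<infinity>\<close> and
  \<open>P(u) = (q u; q)\<^sub>\<infinity> / (g u; q)\<^sub>\<infinity> = R(u) / (1 - u)\<close>. The weight is \<open>R(u) R(1/u)\<close>, and \<open>hcoef m\<close> is the
  coefficient of \<open>u\<^sup>m\<close> in \<open>P(u) R(1/u)\<close>. This quotient of the weight by \<open>1 - u\<close> is easier than the
  weight itself because its Laurent coefficients satisfy a first-order recurrence with linear factors.\<close>

definition pcoef :: "nat \<Rightarrow> complex" where "pcoef k = qbin g q k"
definition rcoef :: "nat \<Rightarrow> complex" where "rcoef k = qbin g 1 k"
definition hcoef :: "nat \<Rightarrow> complex" where "hcoef m = (\<Sum>k. pcoef (k + m) * rcoef k)"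

lemma pcoef_0 [simp]: "pcoef 0 = 1" and rcoef_0 [simp]: "rcoef 0 = 1"
  by (simp_all add: pcoef_def rcoef_def)

lemma pcoef_Suc: "(1 - q ^ Suc k) * pcoef (Suc k) = (g - q ^ Suc k) * pcoef k"
  and rcoef_Suc: "(1 - q ^ Suc k) * rcoef (Suc k) = (g - q ^ k) * rcoef k"
  using qbin_Suc[of k g q] qbin_Suc[of k g 1] by (simp_all add: pcoef_def rcoef_def)

lemma rcoef_Suc_eq_diff: "rcoef (Suc k) = pcoef (Suc k) - pcoef k"
proof -
  have "(1 - q ^ Suc k) * (pcoef (Suc k) - pcoef k) = (g - 1) * pcoef k"
    using pcoef_Suc[of k] by (simp add: algebra_simps)
  moreover have "(1 - q ^ Suc k) * rcoef (Suc k) = (g - 1) * pcoef k"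
    using one_minus_power_nonzero[of k] qfac_nonzero[OF norm_q, of k]
    unfolding rcoef_def pcoef_def qbin_def qfac_Suc prod.lessThan_Suc_shift by simp
  ultimately show ?thesis
    using one_minus_power_nonzero[of k] by (metis mult_left_cancel)
qed

lemma summable_norm_pcoef: "summable (\<lambda>k. norm (pcoef k))"
  and summable_norm_rcoef: "summable (\<lambda>k. norm (rcoef k))"
  using qbin_summable[of g 1] norm_g by (simp_all add: pcoef_def rcoef_def)

lemma summable_norm_mult_shift:
  fixes a b :: "nat \<Rightarrow> complex"
  assumes "summable (\<lambda>k. norm (a k))" "summable (\<lambda>k. norm (b k))"
  shows "summable (\<lambda>k. norm (a (k + m) * b k))"
proof (rule summable_comparison_test')
  show "summable (\<lambda>k. (\<Sum>j. norm (a j)) * norm (b k))"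
    by (intro summable_mult assms)
  fix k :: nat assume "0 \<le> k"
  have "norm (a (k + m)) \<le> (\<Sum>j. norm (a j))"
    using sum_le_suminf[OF assms(1), of "{k + m}"] by simp
  then show "norm (norm (a (k + m) * b k)) \<le> (\<Sum>j. norm (a j)) * norm (b k)"
    by (simp add: norm_mult mult_right_mono)
qed

lemmas summable_norm_prod = 
  summable_norm_mult_shift[OF summable_norm_pcoef summable_norm_pcoef]
  summable_norm_mult_shift[OF summable_norm_pcoef summable_norm_rcoef]
  summable_norm_mult_shift[OF summable_norm_rcoef summable_norm_pcoef]
  summable_norm_mult_shift[OF summable_norm_rcoef summable_norm_rcoef]

lemmas summable_prod = summable_norm_prod[THEN summable_norm_cancel]

lemma hcoef_sums: "(\<lambda>k. pcoef (k + m) * rcoef k) sums hcoef m"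
  unfolding hcoef_def by (intro summable_sums summable_prod)

text \<open>The difference of the two sides, written as a sum over \<open>k\<close>, telescopes.\<close>

lemma hcoef_Suc: "(1 - g * q ^ Suc m) * hcoef (Suc m) = (g - q ^ Suc m) * hcoef m"
proof -
  \<comment> \<open>The summand of the difference of the two sides is the forward difference of D.\<close>
  define D where "D k = - (q ^ Suc m * (1 - q ^ k) * rcoef k * pcoef (k + m))" for k
  have "(\<lambda>k. pcoef (k + m) * rcoef k) \<longlonglongrightarrow> 0"
    using summable_LIMSEQ_zero[OF summable_prod(2)] .
  then have "(\<lambda>k. - (q ^ Suc m * (1 - q ^ k) * (pcoef (k + m) * rcoef k))) \<longlonglongrightarrow> - (q ^ Suc m * (1 - 0) * 0)"
    by (intro tendsto_intros power_q_tendsto_0)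
  then have "D \<longlonglongrightarrow> 0"
    by (simp add: D_def[abs_def] mult_ac)
  from telescope_sums[OF this] have "(\<lambda>k. D (Suc k) - D k) sums 0"
    by (simp add: D_def)
  moreover have "D (Suc k) - D k = (1 - g * q ^ Suc m) * (pcoef (k + Suc m) * rcoef k)
      - (g - q ^ Suc m) * (pcoef (k + m) * rcoef k)" for k
  proof -
    define a y P P' r r' where "a = q ^ k" and "y = q ^ m" and "P = pcoef (k + m)"
      and "P' = pcoef (Suc (k + m))" and "r = rcoef k" and "r' = rcoef (Suc k)"
    have "(1 - q * a * y) * P' = (g - q * a * y) * P"
      using pcoef_Suc[of "k + m"] by (simp add: a_def y_def P_def P'_def power_add mult_ac)
    moreover have "(1 - q * a) * r' = (g - a) * r"
      using rcoef_Suc[of k] by (simp add: a_def r_def r'_def)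
    ultimately have "- (q * y * ((1 - q * a) * r') * P') + q * y * (1 - a) * r * P
        = (1 - g * (q * y)) * (P' * r) - (g - q * y) * (P * r)"
      by algebra
    then show ?thesis
      by (simp add: D_def a_def y_def P_def P'_def r_def r'_def mult_ac)
  qed
  moreover have "(\<lambda>k. (1 - g * q ^ Suc m) * (pcoef (k + Suc m) * rcoef k)
      - (g - q ^ Suc m) * (pcoef (k + m) * rcoef k)) sums
      ((1 - g * q ^ Suc m) * hcoef (Suc m) - (g - q ^ Suc m) * hcoef m)"
    by (intro sums_diff sums_mult hcoef_sums)
  ultimately show ?thesis
    by (auto dest: sums_unique2)
qed

text \<open>A case of the q-Gauss sum \<open>\<^sub>2\<phi>\<^sub>1(a, b; c; q, c/(a b))\<close>, with \<open>a = 1/g\<close>, \<open>b = q/g\<close>, \<open>c = q\<close>. Replacing \<open>c\<close> by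
  \<open>c q\<^sup>N\<close> gives sums \<open>F N\<close> with a first-order recurrence in \<open>N\<close> and limit \<open>1\<close>. The recurrence in the index
  of \<open>hcoef\<close> cannot serve here: its factors \<open>g - q ^ Suc m\<close> vanish when \<open>g\<close> is a power of \<open>q\<close>.\<close>

lemma hcoef_0_eq:
  "hcoef 0 = ((\<Prod>j. 1 - g * q ^ j) * (\<Prod>j. 1 - q * g * q ^ j)) / ((\<Prod>j. 1 - q * q ^ j) * (\<Prod>j. 1 - g\<^sup>2 * q ^ j))"
proof -
  \<comment> \<open>The general term for c = q ^ Suc N, where qfac q N / qfac q (N + k) is the inverse of (q ^ Suc N; q) at k.\<close>
  define t where "t N k = rcoef k * pcoef k * qfac q k * qfac q N / qfac q (N + k) * (q ^ N) ^ k" for N k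
  define F where "F N = (\<Sum>k. t N k)" for N
  have qnz: "qfac q n \<noteq> 0" for n by (rule qfac_nonzero[OF norm_q])
  define K where "K = exp (norm q / (1 - norm q))"
  have K: "K > 0" "\<And>n. norm (qfac q n) \<le> K"
    unfolding K_def by (simp, rule norm_qfac_le)
  obtain K' where K': "K' > 0" "\<And>n. norm (inverse (qfac q n)) \<le> K'"
    using inverse_qfac_bounded[OF norm_q] by blast
  define B where "B = K * K * K'"
  have B: "norm (t N k) \<le> B * norm (rcoef k * pcoef k) * (norm q ^ N) ^ k" for N k
  proof -
    have "t N k = (qfac q k * qfac q N * inverse (qfac q (N + k))) * (rcoef k * pcoef k) * (q ^ N) ^ k"
      by (simp add: t_def field_simps)
    moreover have "norm (qfac q k * qfac q N * inverse (qfac q (N + k))) \<le> B"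
      unfolding norm_mult B_def using K K' by (intro mult_mono) auto
    ultimately show ?thesis
      by (simp add: norm_mult norm_power mult_right_mono)
  qed
  have Bpos: "B > 0" using K K' by (simp add: B_def)
  have le1: "norm q ^ N \<le> 1" for N using norm_q by (intro power_le_one) auto
  have sumB: "summable (\<lambda>k. B * norm (rcoef k * pcoef k))"
    using summable_norm_prod(3)[of 0] by (intro summable_mult) simp
  have tsum: "summable (\<lambda>k. t N k)" for N
  proof (rule summable_comparison_test'[OF sumB])
    fix k :: nat assume "0 \<le> k"
    have "B * norm (rcoef k * pcoef k) * (norm q ^ N) ^ k \<le> B * norm (rcoef k * pcoef k) * 1"
      using Bpos power_le_one[OF _ le1[of N], of k] by (intro mult_left_mono) auto
    then show "norm (t N k) \<le> B * norm (rcoef k * pcoef k)" using B[of N k] by simp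
  qed
  have tSuc: "(1 - q ^ Suc k) * (1 - q ^ Suc (N + k)) * t N (Suc k)
      = (g - q ^ k) * (g - q ^ Suc k) * q ^ N * t N k" for N k
  proof -
    have "(1 - q ^ Suc k) * (1 - q ^ Suc (N + k)) * t N (Suc k)
      = ((1 - q ^ Suc k) * rcoef (Suc k)) * ((1 - q ^ Suc k) * pcoef (Suc k)) * qfac q k * qfac q N
          / qfac q (N + k) * (q ^ N) ^ Suc k"
      using one_minus_power_nonzero[of "N + k"] qnz[of "N + k"]
      by (simp add: t_def qfac_Suc field_simps)
    also have "\<dots> = (g - q ^ k) * (g - q ^ Suc k) * q ^ N * t N k"
      unfolding rcoef_Suc pcoef_Suc by (simp add: t_def)
    finally show ?thesis .
  qed
  have tN: "(1 - q ^ Suc (N + k)) * t (Suc N) k = (1 - q ^ Suc N) * q ^ k * t N k" for N k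
    using one_minus_power_nonzero[of "N + k"] qnz[of "N + k"]
    by (simp add: t_def qfac_Suc field_simps power_mult_distrib)
  have Frec: "(1 - q ^ Suc N) * (1 - g\<^sup>2 * q ^ N) * F N = (1 - g * q ^ N) * (1 - g * q ^ Suc N) * F (Suc N)" for N
  proof -
    \<comment> \<open>The summand of the difference of the two sides is the forward difference of D.\<close>
    define D where "D k = - ((1 - q ^ Suc N) * (1 - q ^ k) * t N k)" for k
    have "t N \<longlonglongrightarrow> 0" using summable_LIMSEQ_zero[OF tsum] .
    then have "D \<longlonglongrightarrow> - ((1 - q ^ Suc N) * (1 - 0) * 0)"
      unfolding D_def by (intro tendsto_intros power_q_tendsto_0)
    from telescope_sums[OF this] have "(\<lambda>k. D (Suc k) - D k) sums 0"
      by (simp add: D_def)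
    moreover have "D (Suc k) - D k = (1 - q ^ Suc N) * (1 - g\<^sup>2 * q ^ N) * t N k
        - (1 - g * q ^ N) * (1 - g * q ^ Suc N) * t (Suc N) k" for k
    proof -
      define a y T T' T'' where "a = q ^ k" and "y = q ^ N" and "T = t N k"
        and "T' = t N (Suc k)" and "T'' = t (Suc N) k"
      have 1: "(1 - q * a) * (1 - q * a * y) * T' = (g - a) * (g - q * a) * y * T"
        using tSuc[of k N] by (simp add: a_def y_def T_def T'_def power_add mult_ac)
      have 2: "(1 - q * a * y) * T'' = (1 - q * y) * a * T"
        using tN[of N k] by (simp add: a_def y_def T_def T''_def power_add mult_ac)
      have nz: "1 - q * a * y \<noteq> 0"
        using one_minus_power_nonzero[of "N + k"] by (simp add: a_def y_def power_add mult_ac)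
      have "(1 - q * a * y) * (- ((1 - q * y) * (1 - q * a) * T') + (1 - q * y) * (1 - a) * T)
         = (1 - q * a * y) * ((1 - q * y) * (1 - g\<^sup>2 * y) * T - (1 - g * y) * (1 - g * (q * y)) * T'')"
        using 1 2 by algebra
      then have "- ((1 - q * y) * (1 - q * a) * T') + (1 - q * y) * (1 - a) * T
         = (1 - q * y) * (1 - g\<^sup>2 * y) * T - (1 - g * y) * (1 - g * (q * y)) * T''"
        using nz by (metis mult_left_cancel)
      then show ?thesis
        by (simp add: D_def a_def y_def T_def T'_def T''_def)
    qed
    moreover have "(\<lambda>k. (1 - q ^ Suc N) * (1 - g\<^sup>2 * q ^ N) * t N k
        - (1 - g * q ^ N) * (1 - g * q ^ Suc N) * t (Suc N) k) sums
       ((1 - q ^ Suc N) * (1 - g\<^sup>2 * q ^ N) * F N - (1 - g * q ^ N) * (1 - g * q ^ Suc N) * F (Suc N))"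
      unfolding F_def by (intro sums_diff sums_mult summable_sums tsum)
    ultimately show ?thesis
      by (auto dest: sums_unique2)
  qed
  have iter: "qfac q N * qfac (g\<^sup>2) N * F 0 = qfac g N * qfac (q * g) N * F N" for N
  proof (induction N)
    case (Suc N)
    have "qfac q (Suc N) * qfac (g\<^sup>2) (Suc N) * F 0
       = (1 - q ^ Suc N) * (1 - g\<^sup>2 * q ^ N) * (qfac q N * qfac (g\<^sup>2) N * F 0)"
      by (simp add: qfac_Suc)
    also have "\<dots> = qfac g N * qfac (q * g) N * ((1 - q ^ Suc N) * (1 - g\<^sup>2 * q ^ N) * F N)"
      unfolding Suc by simp
    also have "\<dots> = qfac g (Suc N) * qfac (q * g) (Suc N) * F (Suc N)"
      unfolding Frec by (simp add: qfac_Suc mult_ac)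
    finally show ?case .
  qed simp
  have "F \<longlonglongrightarrow> 1"
  proof -
    have bound: "norm (F N - 1) \<le> (\<Sum>k. B * norm (rcoef k * pcoef k)) * norm q ^ N" for N
    proof -
      have "t N 0 = 1" using qnz[of N] by (simp add: t_def)
      then have "F N - 1 = (\<Sum>k. t N (Suc k))"
        unfolding F_def by (subst suminf_split_head[OF tsum]) simp
      also have "norm \<dots> \<le> (\<Sum>k. B * norm (rcoef (Suc k) * pcoef (Suc k)) * norm q ^ N)"
      proof (rule norm_suminf_le)
        show "summable (\<lambda>k. B * norm (rcoef (Suc k) * pcoef (Suc k)) * norm q ^ N)"
          using sumB by (intro summable_mult2) (subst summable_Suc_iff)
        fix k
        have "(norm q ^ N) ^ Suc k \<le> norm q ^ N"
          using le1[of N] by (simp add: mult_left_le power_le_one)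
        then have "B * norm (rcoef (Suc k) * pcoef (Suc k)) * (norm q ^ N) ^ Suc k
            \<le> B * norm (rcoef (Suc k) * pcoef (Suc k)) * norm q ^ N"
          using Bpos by (intro mult_left_mono) auto
        with B[of N "Suc k"]
        show "norm (t N (Suc k)) \<le> B * norm (rcoef (Suc k) * pcoef (Suc k)) * norm q ^ N" by simp
      qed
      also have "\<dots> = (\<Sum>k. B * norm (rcoef (Suc k) * pcoef (Suc k))) * norm q ^ N"
        using sumB by (intro suminf_mult2[symmetric]) (subst summable_Suc_iff)
      also have "\<dots> \<le> (\<Sum>k. B * norm (rcoef k * pcoef k)) * norm q ^ N"
        unfolding suminf_split_head[OF sumB] using Bpos by (intro mult_right_mono) auto
      finally show ?thesis .
    qed
    have "(\<lambda>N. (\<Sum>k. B * norm (rcoef k * pcoef k)) * norm q ^ N) \<longlonglongrightarrow> (\<Sum>k. B * norm (rcoef k * pcoef k)) * 0"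
      using norm_q by (intro tendsto_intros LIMSEQ_power_zero) auto
    then have "(\<lambda>N. F N - 1) \<longlonglongrightarrow> 0"
      using bound by (intro Lim_null_comparison[of "\<lambda>N. F N - 1"]) auto
    then show ?thesis by (simp add: LIM_zero_iff)
  qed
  then have "(\<lambda>N. qfac g N * qfac (q * g) N * F N) \<longlonglongrightarrow> (\<Prod>j. 1 - g * q ^ j) * (\<Prod>j. 1 - q * g * q ^ j) * 1"
    by (intro tendsto_mult qfac_tendsto)
  moreover have "(\<lambda>N. qfac q N * qfac (g\<^sup>2) N * F 0) \<longlonglongrightarrow> (\<Prod>j. 1 - q * q ^ j) * (\<Prod>j. 1 - g\<^sup>2 * q ^ j) * F 0"
    by (intro tendsto_mult qfac_tendsto tendsto_const)
  ultimately have eq: "(\<Prod>j. 1 - q * q ^ j) * (\<Prod>j. 1 - g\<^sup>2 * q ^ j) * F 0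
      = (\<Prod>j. 1 - g * q ^ j) * (\<Prod>j. 1 - q * g * q ^ j)"
    unfolding iter by (auto dest: LIMSEQ_unique)
  have "F 0 = hcoef 0"
    using qnz by (simp add: F_def t_def hcoef_def mult_ac)
  moreover have "norm (g\<^sup>2) < 1"
    using norm_g by (simp add: norm_power power_less_one_iff)
  ultimately show ?thesis
    using eq qfac_inf_nonzero[OF norm_q] qfac_inf_nonzero[of "g\<^sup>2"] by (simp add: field_simps)
qed

text \<open>The autocorrelations of \<open>rcoef\<close> are the Laurent coefficients of the weight, which is
  \<open>(1 - u) P(u) R(1/u)\<close>.\<close>

lemma rcoef_autocorrelation_Suc:
  "(\<lambda>k. rcoef (k + Suc s) * rcoef k) sums (hcoef (Suc s) - hcoef s)"
proof -
  have "(\<lambda>k. pcoef (k + Suc s) * rcoef k - pcoef (k + s) * rcoef k) sums (hcoef (Suc s) - hcoef s)"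
    by (intro sums_diff hcoef_sums)
  then show ?thesis by (simp add: rcoef_Suc_eq_diff algebra_simps)
qed

text \<open>Here the factor \<open>1 - u\<close> gives \<open>hcoef 0\<close> minus the coefficient of \<open>1/u\<close> in \<open>P(u) R(1/u)\<close>. These
  two coefficients are opposite, because \<open>u \<mapsto> 1/u\<close> multiplies \<open>P(u) R(1/u)\<close> by \<open>- u\<close>; in terms of the
  autocorrelation \<open>?a\<close> of \<open>pcoef\<close> both equal \<open>?a 0 - ?a 1\<close> up to sign.\<close>

lemma rcoef_autocorrelation_0: "(\<lambda>k. rcoef k * rcoef k) sums (2 * hcoef 0)"
proof -
  let ?a = "\<lambda>m. \<Sum>k. pcoef (k + m) * pcoef k"
  have a: "(\<lambda>k. pcoef (k + m) * pcoef k) sums ?a m" for m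
    by (intro summable_sums summable_prod)
  have "(\<lambda>k. pcoef (Suc k) * rcoef (Suc k)) sums (hcoef 0 - 1)"
    using hcoef_sums[of 0] by (subst sums_Suc_iff) simp
  moreover have "(\<lambda>k. pcoef (Suc k) * rcoef (Suc k)) sums (?a 0 - 1 - ?a 1)"
  proof -
    have "(\<lambda>k. pcoef (Suc k) * pcoef (Suc k)) sums (?a 0 - 1)"
      using a[of 0] by (subst sums_Suc_iff) simp
    from sums_diff[OF this a[of 1]] show ?thesis
      by (simp add: rcoef_Suc_eq_diff algebra_simps)
  qed
  ultimately have h0: "hcoef 0 = ?a 0 - ?a 1"
    by (auto dest: sums_unique2)
  have "(\<lambda>k. rcoef (Suc k) * rcoef (Suc k)) sums (hcoef 0 - 1 - (?a 1 - ?a 0))"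
  proof -
    have "(\<lambda>k. pcoef (Suc k) * rcoef (Suc k)) sums (hcoef 0 - 1)" by fact
    moreover have "(\<lambda>k. rcoef (Suc k) * pcoef k) sums (?a 1 - ?a 0)"
      using sums_diff[OF a[of 1] a[of 0]] by (simp add: rcoef_Suc_eq_diff algebra_simps)
    ultimately have "(\<lambda>k. pcoef (Suc k) * rcoef (Suc k) - rcoef (Suc k) * pcoef k) sums (hcoef 0 - 1 - (?a 1 - ?a 0))"
      by (rule sums_diff)
    then show ?thesis by (simp add: rcoef_Suc_eq_diff algebra_simps)
  qed
  then show ?thesis
    using h0 by (subst (asm) sums_Suc_iff) simp
qed

end

section \<open>Trigonometric moments of the weight\<close>

lemma uniform_series_integral:
  fixes f :: "nat \<Rightarrow> real \<Rightarrow> complex"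
  assumes cont: "\<And>k. continuous_on {a..b} (f k)"
    and bound: "\<And>k x. x \<in> {a..b} \<Longrightarrow> norm (f k x) \<le> M k"
    and "summable M"
  shows "continuous_on {a..b} (\<lambda>x. \<Sum>k. f k x)"
    and "(\<lambda>k. integral {a..b} (f k)) sums integral {a..b} (\<lambda>x. \<Sum>k. f k x)"
proof -
  have ul: "uniform_limit {a..b} (\<lambda>n x. \<Sum>k<n. f k x) (\<lambda>x. \<Sum>k. f k x) sequentially"
    by (rule Weierstrass_m_test[OF bound \<open>summable M\<close>]) auto
  have cont': "continuous_on {a..b} (\<lambda>x. \<Sum>k<n. f k x)" for n
    by (intro continuous_on_sum cont)
  show "continuous_on {a..b} (\<lambda>x. \<Sum>k. f k x)"
    by (rule uniform_limit_theorem[OF _ ul]) (intro always_eventually allI cont', simp)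
  obtain I J where I: "\<And>n. ((\<lambda>x. \<Sum>k<n. f k x) has_integral I n) {a..b}"
    and J: "((\<lambda>x. \<Sum>k. f k x) has_integral J) {a..b}" and "I \<longlonglongrightarrow> J"
    using uniform_limit_integral[OF ul cont'] by auto
  moreover have "I n = (\<Sum>k<n. integral {a..b} (f k))" for n
    using integral_unique[OF I[of n]]
    by (subst (asm) integral_sum) (auto intro: integrable_continuous_real cont)
  ultimately show "(\<lambda>k. integral {a..b} (f k)) sums integral {a..b} (\<lambda>x. \<Sum>k. f k x)"
    using integral_unique[OF J] by (simp add: sums_def LIMSEQ_def)
qed

lemma integral_cis: "integral {-pi..pi} (\<lambda>x. cis (of_int m * x)) = (if m = 0 then 2 * of_real pi else 0)"
proof (cases "m = 0")
  case False
  define F where "F x = exp (\<i> * of_int m * x) / (\<i> * of_int m)" for x :: complex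
  have "((\<lambda>x. F (of_real x)) has_vector_derivative cis (of_int m * x)) (at x within {-pi..pi})" for x
  proof (rule has_vector_derivative_real_field)
    show "(F has_field_derivative cis (of_int m * x)) (at (complex_of_real x))"
      unfolding F_def using False
      by (auto intro!: derivative_eq_intros simp: cis_conv_exp mult_ac)
  qed
  then have "((\<lambda>x. cis (of_int m * x)) has_integral (F (of_real pi) - F (of_real (-pi)))) {-pi..pi}"
    by (intro fundamental_theorem_of_calculus) auto
  moreover have "F (of_real pi) = F (of_real (-pi))"
  proof -
    have "exp (\<i> * of_int m * of_real pi) = exp (\<i> * of_int m * of_real (-pi))"
      by (subst exp_eq) (auto intro!: exI[of _ m] simp: algebra_simps)
    then show ?thesis by (simp add: F_def)
  qed
  ultimately show ?thesis
    using False by (simp add: integral_unique)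
qed (simp add: scaleR_conv_of_real)

context rogers_parameter
begin

definition rser :: "complex \<Rightarrow> complex" where
  "rser u = (\<Sum>k. rcoef k * u ^ k)"

text \<open>The two factors are conjugate for real \<open>q\<close> and \<open>g\<close>. In this form the weight is visibly even
  and both factors can be expanded separately.\<close>

definition weight :: "real \<Rightarrow> complex" where
  "weight \<theta> = rser (cis (2 * \<theta>)) * rser (cis (- 2 * \<theta>))"

lemma integral_mult_rser:
  fixes f :: "real \<Rightarrow> complex" and s :: int
  assumes "continuous_on {-pi..pi} f"
  shows "continuous_on {-pi..pi} (\<lambda>x. f x * rser (cis (2 * of_int s * x)))"
    and "(\<lambda>k. rcoef k * integral {-pi..pi} (\<lambda>x. f x * cis (of_int (2 * s * int k) * x)))
           sums integral {-pi..pi} (\<lambda>x. f x * rser (cis (2 * of_int s * x)))"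
proof -
  obtain B where B: "\<And>x. x \<in> {-pi..pi} \<Longrightarrow> norm (f x) \<le> B"
    using compact_imp_bounded[OF compact_continuous_image[OF assms compact_Icc]]
    by (force simp: bounded_iff)
  let ?f = "\<lambda>k x. rcoef k * (f x * cis (of_int (2 * s * int k) * x))"
  have eq: "(\<Sum>k. ?f k x) = f x * rser (cis (2 * of_int s * x))" for x
  proof -
    have 1: "?f k x = f x * (rcoef k * cis (2 * of_int s * x) ^ k)" for k
      by (simp add: Complex.DeMoivre mult_ac)
    have "summable (\<lambda>k. rcoef k * cis (2 * of_int s * x) ^ k)"
      by (rule summable_norm_cancel) (simp add: norm_mult norm_power summable_norm_rcoef)
    then show ?thesis unfolding 1 rser_def by (rule suminf_mult)
  qed
  have cont: "continuous_on {-pi..pi} (?f k)" for k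
    by (intro continuous_intros assms)
  have bound: "norm (?f k x) \<le> norm (rcoef k) * B" if "x \<in> {-pi..pi}" for k x
    using B[OF that] by (simp add: norm_mult mult_left_mono)
  have sm: "summable (\<lambda>k. norm (rcoef k) * B)"
    by (intro summable_mult2 summable_norm_rcoef)
  note * = uniform_series_integral[of "-pi" pi ?f, OF cont bound sm]
  show "continuous_on {-pi..pi} (\<lambda>x. f x * rser (cis (2 * of_int s * x)))"
    using *(1) by (simp only: eq)
  show "(\<lambda>k. rcoef k * integral {-pi..pi} (\<lambda>x. f x * cis (of_int (2 * s * int k) * x)))
           sums integral {-pi..pi} (\<lambda>x. f x * rser (cis (2 * of_int s * x)))"
    using *(2) by (simp only: eq integral_mult_right)
qed

lemma continuous_on_weight: "continuous_on {-pi..pi} weight"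
  using integral_mult_rser(1)[OF integral_mult_rser(1)[of "\<lambda>_. 1" 1], of "-1"]
  by (simp add: weight_def[abs_def])

lemma weight_even: "weight (- \<theta>) = weight \<theta>"
  by (simp add: weight_def)

definition trig_moment :: "int \<Rightarrow> complex" where
  "trig_moment m = integral {-pi..pi} (\<lambda>x. cis (of_int m * x) * weight x)"

lemma trig_moment_minus: "trig_moment (- m) = trig_moment m"
proof -
  have "((\<lambda>x. cis (of_int m * x) * weight x) has_integral trig_moment m) {-pi..pi}"
    unfolding trig_moment_def
    by (intro integrable_integral integrable_continuous_real continuous_intros continuous_on_weight)
  then have "((\<lambda>x. cis (of_int m * (- x)) * weight (- x)) has_integral trig_moment m) {-pi..- (-pi)}"
    using has_integral_reflect_real[of "\<lambda>x. cis (of_int m * x) * weight x" "trig_moment m" pi "-pi"] by simp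
  then show ?thesis
    unfolding trig_moment_def weight_even by (simp add: integral_unique)
qed

lemma integral_cis_rser:
  "integral {-pi..pi} (\<lambda>x. cis (of_int m * x) * rser (cis (2 * x)))
     = (if even m \<and> m \<le> 0 then 2 * of_real pi * rcoef (nat (- m div 2)) else 0)"
proof -
  let ?c = "\<lambda>k. rcoef k * integral {-pi..pi} (\<lambda>x. cis (of_int (m + 2 * int k) * x))"
  have s: "?c sums integral {-pi..pi} (\<lambda>x. cis (of_int m * x) * rser (cis (2 * x)))"
    using integral_mult_rser(2)[of "\<lambda>x. cis (of_int m * x)" 1]
    by (simp add: cis_mult distrib_right continuous_intros)
  show ?thesis
  proof (cases "even m \<and> m \<le> 0")
    case True
    then have "m = - 2 * int (nat (- m div 2))" by auto
    then have "?c = (\<lambda>k. if k = nat (- m div 2) then 2 * of_real pi * rcoef k else 0)"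
      unfolding integral_cis by (intro ext) auto
    with s have "(\<lambda>k. if k = nat (- m div 2) then 2 * of_real pi * rcoef k else 0) sums integral {-pi..pi} (\<lambda>x. cis (of_int m * x) * rser (cis (2 * x)))"
      by simp
    moreover have "(\<lambda>k. if k = nat (- m div 2) then 2 * of_real pi * rcoef k else 0) sums (2 * of_real pi * rcoef (nat (- m div 2)))"
      by (rule sums_single)
    ultimately show ?thesis using True by (simp add: sums_unique2)
  next
    case False
    then have "m + 2 * int k \<noteq> 0" for k by presburger
    then have "?c = (\<lambda>k. 0)"
      unfolding integral_cis by auto
    with s have "(\<lambda>k. 0) sums integral {-pi..pi} (\<lambda>x. cis (of_int m * x) * rser (cis (2 * x)))" by simp
    then have "integral {-pi..pi} (\<lambda>x. cis (of_int m * x) * rser (cis (2 * x))) = 0"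
      by (metis sums_unique2 sums_zero)
    then show ?thesis unfolding if_not_P[OF False] .
  qed
qed

text \<open>Only one frequency of the first series survives against each term of the second one.\<close>

lemma trig_moment_sums:
  "(\<lambda>k. rcoef k * (if even m \<and> m \<le> 2 * int k then 2 * of_real pi * rcoef (nat ((2 * int k - m) div 2)) else 0)) sums trig_moment m"
proof -
  have "(\<lambda>k. rcoef k * integral {-pi..pi} (\<lambda>x. (cis (of_int m * x) * rser (cis (2 * x))) * cis (of_int (2 * - 1 * int k) * x)))
     sums integral {-pi..pi} (\<lambda>x. (cis (of_int m * x) * rser (cis (2 * x))) * rser (cis (2 * of_int (- 1) * x)))"
    using integral_mult_rser(1)[of "\<lambda>x. cis (of_int m * x)" 1]
    by (intro integral_mult_rser(2)) (simp add: continuous_intros)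
  moreover have "(\<lambda>x. (cis (of_int m * x) * rser (cis (2 * x))) * cis (of_int (2 * - 1 * int k) * x))
     = (\<lambda>x. cis (of_int (m - 2 * int k) * x) * rser (cis (2 * x)))" for k
  proof
    fix x
    have "cis (of_int m * x) * cis (of_int (2 * - 1 * int k) * x) = cis (of_int (m - 2 * int k) * x)"
      unfolding cis_mult by (simp add: algebra_simps)
    then show "(cis (of_int m * x) * rser (cis (2 * x))) * cis (of_int (2 * - 1 * int k) * x)
       = cis (of_int (m - 2 * int k) * x) * rser (cis (2 * x))"
      by (metis mult.assoc mult.commute)
  qed
  moreover have "(\<lambda>x. (cis (of_int m * x) * rser (cis (2 * x))) * rser (cis (2 * of_int (- 1) * x)))
     = (\<lambda>x. cis (of_int m * x) * weight x)"
    by (simp add: weight_def mult_ac)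
  ultimately have "(\<lambda>k. rcoef k * integral {-pi..pi} (\<lambda>x. cis (of_int (m - 2 * int k) * x) * rser (cis (2 * x))))
     sums trig_moment m"
    by (simp only: trig_moment_def)
  then show ?thesis
    unfolding integral_cis_rser minus_diff_eq by simp
qed

lemma trig_moment_odd: "odd m \<Longrightarrow> trig_moment m = 0"
  using sums_unique2[OF trig_moment_sums[of m] ] by simp

lemma trig_moment_0: "trig_moment 0 = 4 * of_real pi * hcoef 0"
proof -
  have "(\<lambda>k. 2 * of_real pi * (rcoef k * rcoef k)) sums (2 * of_real pi * (2 * hcoef 0))"
    by (intro sums_mult rcoef_autocorrelation_0)
  moreover have "(\<lambda>k. 2 * of_real pi * (rcoef k * rcoef k)) sums trig_moment 0"
    using trig_moment_sums[of 0] by (simp add: mult_ac)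
  ultimately show ?thesis by (auto dest: sums_unique2)
qed

lemma trig_moment_Suc:
  "trig_moment (- 2 * int (Suc s)) = 2 * of_real pi * (hcoef (Suc s) - hcoef s)"
proof -
  have "nat ((2 * int k - - 2 * int (Suc s)) div 2) = k + Suc s" for k by simp
  then have "(\<lambda>k. 2 * of_real pi * (rcoef (k + Suc s) * rcoef k)) sums trig_moment (- 2 * int (Suc s))"
    using trig_moment_sums[of "- 2 * int (Suc s)"] by (simp add: mult_ac del: of_nat_Suc)
  then show ?thesis
    using sums_mult[OF rcoef_autocorrelation_Suc[of s], of "2 * of_real pi"] by (auto dest: sums_unique2)
qed

end

section \<open>Rogers polynomials and their mean values\<close>

lemma sum_symmetric_split:
  fixes f :: "nat \<Rightarrow> complex"
  shows "(\<Sum>k\<le>2 * i. f k) = f i + (\<Sum>s<i. f (i + Suc s) + f (i - Suc s))"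
proof (induction i arbitrary: f)
  case (Suc i)
  have "(\<Sum>k\<le>2 * Suc i. f k) = f 0 + (\<Sum>k\<le>2 * i. f (Suc k)) + f (2 * i + 2)"
    using sum.atMost_Suc_shift[of f "2 * i"] by simp
  also have "(\<Sum>k\<le>2 * i. f (Suc k)) = f (Suc i) + (\<Sum>s<i. f (Suc (i + Suc s)) + f (Suc (i - Suc s)))"
    by (rule Suc.IH)
  also have "(\<Sum>s<i. f (Suc (i + Suc s)) + f (Suc (i - Suc s))) = (\<Sum>s<i. f (Suc i + Suc s) + f (Suc i - Suc s))"
    by (intro sum.cong) (auto simp: Suc_diff_Suc)
  finally show ?case by (simp add: add_ac mult_2)
qed simp

lemma fps_nth_linear_Suc:
  "fps_nth ((1 - fps_const s * fps_X) * F) (Suc n) = fps_nth F (Suc n) - s * fps_nth F n"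
  and fps_nth_linear_0: "fps_nth ((1 - fps_const s * fps_X) * F) 0 = fps_nth F 0"
  for F :: "complex fps"
  by (simp_all add: left_diff_distrib mult.assoc)

lemma fps_nth_quadratic_Suc_Suc:
  "fps_nth ((1 - fps_const s * fps_X) * (1 - fps_const t * fps_X) * F) (Suc (Suc n)) =
     fps_nth F (Suc (Suc n)) - (s + t) * fps_nth F (Suc n) + s * t * fps_nth F n"
  and fps_nth_quadratic_1:
  "fps_nth ((1 - fps_const s * fps_X) * (1 - fps_const t * fps_X) * F) (Suc 0) =
     fps_nth F (Suc 0) - (s + t) * fps_nth F 0"
  for F :: "complex fps"
  unfolding mult.assoc fps_nth_linear_Suc fps_nth_linear_0 by (simp_all add: algebra_simps)


context q_base
begin

text \<open>Rogers' finite Fourier expansion: for \<open>z = e\<^sup>i\<^sup>\<theta>\<close> this is \<open>C\<^sub>n(cos \<theta>; a|q)\<close>. As a Cauchy product it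
  is the coefficient of \<open>X\<^sup>n\<close> in a product of two q-binomial series.\<close>

definition rogers :: "complex \<Rightarrow> nat \<Rightarrow> complex \<Rightarrow> complex" where
  "rogers a n z = (\<Sum>k\<le>n. qbin 1 a k * qbin 1 a (n - k) * (z ^ k * inverse z ^ (n - k)))"

text \<open>The substitution \<open>F(X) \<mapsto> F(q X)\<close>.\<close>

definition dilate :: "complex fps \<Rightarrow> complex fps" where
  "dilate F = Abs_fps (\<lambda>n. q ^ n * fps_nth F n)"

lemma dilate_nth [simp]: "fps_nth (dilate F) n = q ^ n * fps_nth F n"
  by (simp add: dilate_def)

lemma dilate_mult: "dilate (F * G) = dilate F * dilate G"
proof (rule fps_ext)
  fix n
  have "fps_nth (dilate (F * G)) n = (\<Sum>i=0..n. q ^ n * (fps_nth F i * fps_nth G (n - i)))"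
    by (simp add: fps_mult_nth sum_distrib_left)
  also have "\<dots> = (\<Sum>i=0..n. (q ^ i * fps_nth F i) * (q ^ (n - i) * fps_nth G (n - i)))"
  proof (intro sum.cong refl)
    fix i assume "i \<in> {0..n}"
    then have "q ^ n = q ^ i * q ^ (n - i)" by (simp add: power_add[symmetric])
    then show "q ^ n * (fps_nth F i * fps_nth G (n - i)) = (q ^ i * fps_nth F i) * (q ^ (n - i) * fps_nth G (n - i))"
      by simp
  qed
  finally show "fps_nth (dilate (F * G)) n = fps_nth (dilate F * dilate G) n"
    by (simp add: fps_mult_nth)
qed

definition qbin_fps :: "complex \<Rightarrow> complex \<Rightarrow> complex fps" where
  "qbin_fps a s = Abs_fps (\<lambda>k. qbin 1 a k * s ^ k)"

lemma dilate_const_X: "dilate (1 - fps_const s * fps_X) = 1 - fps_const (q * s) * fps_X"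
proof (rule fps_ext)
  fix n
  show "fps_nth (dilate (1 - fps_const s * fps_X)) n = fps_nth (1 - fps_const (q * s) * fps_X) n"
    by (cases "n = 0"; cases "n = 1") auto
qed

lemma qbin_fps_dilate:
  "(1 - fps_const s * fps_X) * qbin_fps a s = (1 - fps_const (a * s) * fps_X) * dilate (qbin_fps a s)"
proof (rule fps_ext)
  fix n
  show "fps_nth ((1 - fps_const s * fps_X) * qbin_fps a s) n
      = fps_nth ((1 - fps_const (a * s) * fps_X) * dilate (qbin_fps a s)) n"
  proof (cases n)
    case (Suc m)
    have "s ^ Suc m * qbin 1 a (Suc m) - s ^ Suc m * qbin 1 a m
      = s ^ Suc m * q ^ Suc m * qbin 1 a (Suc m) - a * s ^ Suc m * q ^ m * qbin 1 a m"
    proof -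
      have "S * B' - S * B = S * Q' * B' - a * S * Q * B" if "(1 - Q') * B' = (1 - a * Q) * B"
        for S B B' Q Q' :: complex
        using that by algebra
      from this[OF qbin_Suc[of m 1 a]] show ?thesis .
    qed
    then show ?thesis
      unfolding Suc fps_nth_linear_Suc by (simp add: qbin_fps_def mult_ac)
  qed (simp add: qbin_fps_def)
qed

lemma rogers_fps: "fps_nth (qbin_fps a z * qbin_fps a (inverse z)) n = rogers a n z"
  by (simp add: fps_mult_nth rogers_def qbin_fps_def atMost_atLeast0 mult_ac)

lemma rogers_0: "rogers a 0 z = 1"
  by (simp add: rogers_def)

text \<open>Multiplying the first-order q-difference equations of the two factors gives
  \<open>(1 - z X) (1 - X/z) F(X) = (1 - a z X) (1 - a X/z) F(q X)\<close> for the generating function \<open>F\<close>; compare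
  coefficients.\<close>

lemma rogers_recurrence:
  assumes "z \<noteq> 0"
  shows "(1 - q) * rogers a (Suc 0) z = (1 - a) * (z + inverse z) * rogers a 0 z"
    and "(1 - q ^ Suc (Suc n)) * rogers a (Suc (Suc n)) z =
      (1 - a * q ^ Suc n) * (z + inverse z) * rogers a (Suc n) z - (1 - a\<^sup>2 * q ^ n) * rogers a n z"
proof -
  define F where "F = qbin_fps a z * qbin_fps a (inverse z)"
  have "((1 - fps_const z * fps_X) * qbin_fps a z) * ((1 - fps_const (inverse z) * fps_X) * qbin_fps a (inverse z))
      = ((1 - fps_const (a * z) * fps_X) * dilate (qbin_fps a z))
        * ((1 - fps_const (a * inverse z) * fps_X) * dilate (qbin_fps a (inverse z)))"
    unfolding qbin_fps_dilate ..
  then have eq: "(1 - fps_const z * fps_X) * (1 - fps_const (inverse z) * fps_X) * F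
    = (1 - fps_const (a * z) * fps_X) * (1 - fps_const (a * inverse z) * fps_X) * dilate F"
    unfolding F_def dilate_mult by (simp only: mult_ac)
  have F: "fps_nth F n = rogers a n z" for n
    unfolding F_def by (rule rogers_fps)
  show "(1 - q) * rogers a (Suc 0) z = (1 - a) * (z + inverse z) * rogers a 0 z"
    using arg_cong[OF eq, of "\<lambda>F. fps_nth F (Suc 0)"]
    unfolding fps_nth_quadratic_1 dilate_nth F by (simp add: algebra_simps)
  have "rogers a (Suc (Suc n)) z - (z + inverse z) * rogers a (Suc n) z + rogers a n z
    = q ^ Suc (Suc n) * rogers a (Suc (Suc n)) z - a * (z + inverse z) * q ^ Suc n * rogers a (Suc n) z
      + a\<^sup>2 * q ^ n * rogers a n z"
    using arg_cong[OF eq, of "\<lambda>F. fps_nth F (Suc (Suc n))"] assms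
    unfolding fps_nth_quadratic_Suc_Suc dilate_nth F
    by (simp add: power2_eq_square field_simps)
  moreover have "(1 - Q2) * R2 = (1 - a * Q1) * x * R1 - (1 - a\<^sup>2 * Q0) * R0"
    if "R2 - x * R1 + R0 = Q2 * R2 - a * x * Q1 * R1 + a\<^sup>2 * Q0 * R0"
    for x R0 R1 R2 Q0 Q1 Q2 :: complex
    using that by algebra
  ultimately show "(1 - q ^ Suc (Suc n)) * rogers a (Suc (Suc n)) z =
      (1 - a * q ^ Suc n) * (z + inverse z) * rogers a (Suc n) z - (1 - a\<^sup>2 * q ^ n) * rogers a n z"
    by blast
qed

lemma rogers_cis:
  "rogers a n (cis \<theta>) = (\<Sum>k\<le>n. qbin 1 a k * qbin 1 a (n - k) * cis (of_int (2 * int k - int n) * \<theta>))"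
  unfolding rogers_def
proof (intro sum.cong refl arg_cong2[where f="(*)"])
  fix k assume "k \<in> {..n}"
  then have "real k * \<theta> + real (n - k) * (- \<theta>) = of_int (2 * int k - int n) * \<theta>"
    by (simp add: of_nat_diff algebra_simps)
  then show "cis \<theta> ^ k * inverse (cis \<theta>) ^ (n - k) = cis (of_int (2 * int k - int n) * \<theta>)"
    by (simp only: cis_inverse Complex.DeMoivre cis_mult)
qed

lemma continuous_on_rogers_cis [continuous_intros]: "continuous_on S (\<lambda>\<theta>. rogers a n (cis \<theta>))"
  unfolding rogers_cis by (intro continuous_intros)

end

context rogers_parameter
begin

text \<open>Integration over the full circle, where frequencies separate. For even \<open>f\<close> it is twice the
  integral over \<open>x \<in> (-1, 1)\<close> with respect to \<open>w(x) dx / sqrt (1 - x\<^sup>2)\<close>, where \<open>\<theta> = arccos x\<close>.\<close>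

definition weight_int :: "(real \<Rightarrow> complex) \<Rightarrow> complex" where
  "weight_int f = integral {-pi..pi} (\<lambda>x. f x * weight x)"

text \<open>The mean value of \<open>C\<^sub>2\<^sub>i\<close> is the case \<open>S = i\<close> of the left-hand sum, up to constants. Its partial
  sums have a closed form, with the factor \<open>1 - q ^ (i - S)\<close> that vanishes for \<open>S = i\<close>.\<close>

lemma rogers_mean_telescope:
  assumes "S \<le> i"
  defines "c \<equiv> qbin 1 g"
  shows "(1 - g * q ^ i) * (1 - q ^ i) *
      (c i * c i * hcoef 0 + (\<Sum>s<S. c (i + Suc s) * c (i - Suc s) * (hcoef (Suc s) - hcoef s)))
    = c (i + S) * c (i - S) * hcoef S * (1 - q ^ (i - S)) * (1 - g * q ^ (i + S))"
  using assms(1)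
proof (induction S)
  case (Suc S)
  define d where "d = i - Suc S"
  have i: "i = Suc (S + d)" using Suc.prems by (simp add: d_def)
  define y D h h' A A' B B' where "y = q ^ Suc S" and "D = q ^ d" and "h = hcoef S" and "h' = hcoef (Suc S)"
    and "A = c (i + S)" and "A' = c (i + Suc S)" and "B = c (i - S)" and "B' = c (i - Suc S)"
  have A: "(1 - y * D * y) * A' = (1 - g * q ^ (i + S)) * A"
    using qbin_Suc[of "i + S" 1 g] by (simp add: A_def A'_def c_def y_def D_def i power_add mult_ac)
  have "i - S = Suc d" "i - Suc S = d" using i by simp_all
  then have B: "(1 - q ^ (i - S)) * B = (1 - g * D) * B'"
    using qbin_Suc[of d 1 g] by (simp add: B_def B'_def c_def D_def)
  have h: "(1 - g * y) * h' = (g - y) * h"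
    using hcoef_Suc[of S] by (simp add: h_def h'_def y_def)
  have Q: "q ^ i = y * D" "q ^ (i - Suc S) = D" "q ^ (i + Suc S) = y * D * y"
    by (simp_all add: i y_def D_def power_add mult_ac)
  have "(1 - g * q ^ i) * (1 - q ^ i) *
      (c i * c i * hcoef 0 + (\<Sum>s<Suc S. c (i + Suc s) * c (i - Suc s) * (hcoef (Suc s) - hcoef s)))
     = (1 - g * q ^ i) * (1 - q ^ i) *
      (c i * c i * hcoef 0 + (\<Sum>s<S. c (i + Suc s) * c (i - Suc s) * (hcoef (Suc s) - hcoef s)))
      + (1 - g * q ^ i) * (1 - q ^ i) * (A' * B' * (h' - h))"
    by (simp add: distrib_left A'_def B'_def h'_def h_def add.assoc)
  also have "\<dots> = A * B * h * (1 - q ^ (i - S)) * (1 - g * q ^ (i + S)) + (1 - g * (y * D)) * (1 - y * D) * (A' * B' * (h' - h))"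
    using Suc unfolding A_def B_def h_def Q by simp
  also have "\<dots> = ((1 - g * q ^ (i + S)) * A) * ((1 - q ^ (i - S)) * B) * h + (1 - g * (y * D)) * (1 - y * D) * (A' * B' * (h' - h))"
    by (simp only: mult_ac)
  also have "\<dots> = A' * B' * ((1 - y * D * y) * (1 - g * D) * h + (1 - g * (y * D)) * (1 - y * D) * (h' - h))"
    unfolding A[symmetric] B by (simp add: algebra_simps)
  also have "(1 - y * D * y) * (1 - g * D) * h + (1 - g * (y * D)) * (1 - y * D) * (h' - h) = h' * (1 - D) * (1 - g * (y * D * y))"
  proof -
    have "(1 - g * y) * ((1 - y * D * y) * (1 - g * D) * h + (1 - g * (y * D)) * (1 - y * D) * (h' - h))
       = (1 - g * y) * (h' * (1 - D) * (1 - g * (y * D * y)))"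
      using h by algebra
    moreover have "1 - g * y \<noteq> 0"
      unfolding y_def by (rule one_minus_nonzero[OF norm_g])
    ultimately show ?thesis by (metis mult_left_cancel)
  qed
  also have "A' * B' * (h' * (1 - D) * (1 - g * (y * D * y))) =
     c (i + Suc S) * c (i - Suc S) * hcoef (Suc S) * (1 - q ^ (i - Suc S)) * (1 - g * q ^ (i + Suc S))"
    unfolding Q A'_def B'_def h'_def by (simp only: mult_ac)
  finally show ?case .
qed simp

text \<open>Odd \<open>n\<close> gives only odd frequencies, while the weight has only even ones. For even \<open>n\<close> the
  frequencies \<open>s\<close> and \<open>- s\<close> are paired and the sum telescopes.\<close>

lemma weight_int_rogers: "weight_int (\<lambda>x. rogers g n (cis x)) = (if n = 0 then 4 * of_real pi * hcoef 0 else 0)"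
proof -
  define c where "c = qbin 1 g"
  have "(\<lambda>x. rogers g n (cis x) * weight x) = (\<lambda>x. \<Sum>k\<le>n. c k * c (n - k) * (cis (of_int (2 * int k - int n) * x) * weight x))"
    unfolding rogers_cis c_def sum_distrib_right by (simp only: mult.assoc)
  then have eq: "weight_int (\<lambda>x. rogers g n (cis x)) = (\<Sum>k\<le>n. c k * c (n - k) * trig_moment (2 * int k - int n))"
    unfolding weight_int_def trig_moment_def
    by (simp only:) (subst integral_sum, auto intro!: integrable_continuous_real continuous_intros continuous_on_weight)
  show ?thesis
  proof (cases "even n")
    case False
    then have "odd (2 * int k - int n)" for k by simp
    with eq have "weight_int (\<lambda>x. rogers g n (cis x)) = 0" by (simp add: trig_moment_odd)
    with False show ?thesis by (auto intro: ccontr)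
  next
    case True
    then obtain i where i: "n = 2 * i" by (elim evenE)
    have mom: "trig_moment (2 * int (i + Suc s) - int n) = 2 * of_real pi * (hcoef (Suc s) - hcoef s)"
      "trig_moment (2 * int (i - Suc s) - int n) = 2 * of_real pi * (hcoef (Suc s) - hcoef s)" if "s < i" for s
    proof -
      have "2 * int (i + Suc s) - int n = - (- 2 * int (Suc s))" by (simp add: i)
      then show "trig_moment (2 * int (i + Suc s) - int n) = 2 * of_real pi * (hcoef (Suc s) - hcoef s)"
        by (metis trig_moment_minus trig_moment_Suc)
      have "2 * int (i - Suc s) - int n = - 2 * int (Suc s)" using that by (simp add: i of_nat_diff)
      then show "trig_moment (2 * int (i - Suc s) - int n) = 2 * of_real pi * (hcoef (Suc s) - hcoef s)"
        by (metis trig_moment_Suc)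
    qed
    define T where "T = c i * c i * hcoef 0 + (\<Sum>s<i. c (i + Suc s) * c (i - Suc s) * (hcoef (Suc s) - hcoef s))"
    have "weight_int (\<lambda>x. rogers g n (cis x)) = c i * c i * trig_moment 0 +
       (\<Sum>s<i. c (i + Suc s) * c (n - (i + Suc s)) * trig_moment (2 * int (i + Suc s) - int n)
          + c (i - Suc s) * c (n - (i - Suc s)) * trig_moment (2 * int (i - Suc s) - int n))"
      unfolding eq using sum_symmetric_split[of "\<lambda>k. c k * c (n - k) * trig_moment (2 * int k - int n)" i]
      by (simp add: i)
    also have "\<dots> = 4 * of_real pi * T"
    proof -
      have "(\<Sum>s<i. c (i + Suc s) * c (n - (i + Suc s)) * trig_moment (2 * int (i + Suc s) - int n)
          + c (i - Suc s) * c (n - (i - Suc s)) * trig_moment (2 * int (i - Suc s) - int n))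
         = (\<Sum>s<i. 4 * of_real pi * (c (i + Suc s) * c (i - Suc s) * (hcoef (Suc s) - hcoef s)))"
      proof (intro sum.cong refl)
        fix s assume "s \<in> {..<i}"
        then have s: "s < i" by simp
        then have "n - (i + Suc s) = i - Suc s" "n - (i - Suc s) = i + Suc s" by (auto simp: i)
        then show "c (i + Suc s) * c (n - (i + Suc s)) * trig_moment (2 * int (i + Suc s) - int n)
          + c (i - Suc s) * c (n - (i - Suc s)) * trig_moment (2 * int (i - Suc s) - int n)
          = 4 * of_real pi * (c (i + Suc s) * c (i - Suc s) * (hcoef (Suc s) - hcoef s))"
          unfolding mom[OF s] by (simp add: mult_ac)
      qed
      then show ?thesis
        by (simp add: T_def trig_moment_0 sum_distrib_left[symmetric] distrib_left)
    qed
    finally have W: "weight_int (\<lambda>x. rogers g n (cis x)) = 4 * of_real pi * T" .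
    show ?thesis
    proof (cases "n = 0")
      case True
      then show ?thesis using W by (simp add: T_def i c_def)
    next
      case False
      then obtain i' where i': "i = Suc i'" using i by (cases i) auto
      have "(1 - g * q ^ i) * (1 - q ^ i) * T = 0"
        using rogers_mean_telescope[of i i] by (simp add: T_def c_def)
      moreover have "1 - q ^ i \<noteq> 0" unfolding i' by (rule one_minus_power_nonzero)
      ultimately have "T = 0" using one_minus_nonzero[OF norm_g, of i] by simp
      then show ?thesis using W False by simp
    qed
  qed
qed

end

section \<open>The generating function\<close>

lemma fps_nth_affine_Suc:
  "fps_nth ((fps_const c + fps_const d * fps_X) * F) (Suc n) = c * fps_nth F (Suc n) + d * fps_nth F n"
  for F :: "complex fps"
  by (simp add: distrib_right mult.assoc)

context q_base
begin

text \<open>The coefficient of \<open>t\<^sup>k\<close> in \<open>\<^sub>2\<phi>\<^sub>1(a, a z\<^sup>2; a\<^sup>2; q, t/z)\<close>.\<close>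

definition ecoef :: "complex \<Rightarrow> complex \<Rightarrow> nat \<Rightarrow> complex" where
  "ecoef a z k = qfac a k * qfac (a * z\<^sup>2) k / (qfac q k * qfac (a\<^sup>2) k) * inverse z ^ k"

lemma ecoef_Suc:
  assumes "norm a < 1" "z \<noteq> 0"
  shows "(1 - q ^ Suc k) * (1 - a\<^sup>2 * q ^ k) * z * ecoef a z (Suc k)
    = (1 - a * q ^ k) * (1 - a * z\<^sup>2 * q ^ k) * ecoef a z k"
proof -
  have a2: "norm (a\<^sup>2) < 1" using assms(1) by (simp add: norm_power power_less_one_iff)
  show ?thesis
    using qfac_nonzero[OF norm_q, of k] qfac_nonzero[OF a2, of k] one_minus_power_nonzero[of k]
      one_minus_nonzero[OF a2, of k] assms(2)
    by (simp add: ecoef_def qfac_Suc divide_simps)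
qed

text \<open>The product \<open>D = E V\<close> of the \<open>\<^sub>2\<phi>\<^sub>1\<close> series \<open>E\<close> with \<open>V(X) = 1 / (z X; q)\<^sub>\<infinity>\<close> inherits from \<open>E\<close> a
  second-order q-difference equation, since \<open>V(q X) = (1 - z X) V(X)\<close>. The recurrence that this gives for
  the coefficients of \<open>D\<close> is that of \<open>C\<^sub>n(x; a|q) / (a\<^sup>2; q)\<^sub>n\<close>.\<close>

lemma rogers_eq_fps:
  assumes "norm a < 1" "z \<noteq> 0" "q \<noteq> 0"
  shows "rogers a n z = qfac (a\<^sup>2) n * fps_nth (Abs_fps (ecoef a z) * qbin_fps 0 z) n"
proof -
  define s where "s = z + inverse z"
  define E where "E = Abs_fps (ecoef a z)"
  define V where "V = qbin_fps 0 z"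
  define L where "L = 1 - fps_const z * fps_X"
  define A where "A = fps_const (- (q + a\<^sup>2)) + fps_const (q * a * s) * fps_X"
  have V: "dilate V = L * V"
    using qbin_fps_dilate[of z 0] by (simp add: V_def L_def)
  have DL: "dilate L = 1 - fps_const (q * z) * fps_X"
    unfolding L_def by (rule dilate_const_X)
  \<comment> \<open>The recurrence of ecoef as a q-difference equation; the overall factor q clears the parameter a^2 / q that comes from shifting the index.\<close>
  have E: "(fps_const q + fps_const (- q * inverse z) * fps_X) * E + A * dilate E
     + (fps_const (a\<^sup>2) + fps_const (- a\<^sup>2 * q * z) * fps_X) * dilate (dilate E) = 0" (is "?lhs = 0")
  proof (rule fps_ext)
    fix n
    show "fps_nth ?lhs n = fps_nth 0 n"
    proof (cases n)
      case 0
      then show ?thesis by (simp add: A_def distrib_right mult.assoc algebra_simps)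
    next
      case (Suc m)
      have zi: "z * inverse z = 1" using assms(2) by simp
      have "q * e' - q * zi * e + ((- q - a\<^sup>2) * (q * y * e') + q * a * (z + zi) * (y * e))
          + (a\<^sup>2 * (q * y * (q * y * e')) - a\<^sup>2 * q * z * (y * (y * e))) = 0"
        if "(1 - q * y) * (1 - a\<^sup>2 * y) * z * e' = (1 - a * y) * (1 - a * z\<^sup>2 * y) * e" "z * zi = 1"
        for y e e' zi
        using that by algebra
      from this[OF _ zi, of "q ^ m" "ecoef a z (Suc m)" "ecoef a z m"] ecoef_Suc[OF assms(1,2), of m]
      show ?thesis
        unfolding Suc fps_add_nth A_def fps_nth_affine_Suc by (simp add: E_def s_def)
    qed
  qed
  define D where "D = E * V"
  have dil: "dilate D = dilate E * (L * V)" "dilate (dilate D) = dilate (dilate E) * (dilate L * (L * V))"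
    unfolding D_def dilate_mult V by simp_all
  have C: "fps_const q + fps_const (- q * inverse z) * fps_X = fps_const q * (1 - fps_const (inverse z) * fps_X)"
    "fps_const (a\<^sup>2) + fps_const (- a\<^sup>2 * q * z) * fps_X = fps_const (a\<^sup>2) * dilate L"
    unfolding DL by (simp_all add: algebra_simps flip: fps_const_neg)
  have "c * (L * I * (E * V)) + A * (E1 * (L * V)) + c' * (E2 * (L1 * (L * V)))
      = L * V * (c * I * E + A * E1 + c' * L1 * E2)" for c c' I E1 E2 L1 :: "complex fps"
    by (simp add: algebra_simps)
  then have "fps_const q * ((1 - fps_const z * fps_X) * (1 - fps_const (inverse z) * fps_X) * D)
    + A * dilate D + fps_const (a\<^sup>2) * dilate (dilate D)
     = L * V * (fps_const q * (1 - fps_const (inverse z) * fps_X) * E + A * dilate E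
        + fps_const (a\<^sup>2) * dilate L * dilate (dilate E))"
    unfolding dil(2) unfolding dil(1) unfolding D_def L_def[symmetric] .
  also have "\<dots> = 0"
    using E unfolding C by simp
  finally have D: "fps_const q * ((1 - fps_const z * fps_X) * (1 - fps_const (inverse z) * fps_X) * D)
    + A * dilate D + fps_const (a\<^sup>2) * dilate (dilate D) = 0" .
  have cnv: "fps_nth (fps_const c * F) n = c * fps_nth F n" for c n and F :: "complex fps" by simp
  have D1: "(1 - q) * (1 - a\<^sup>2) * fps_nth D (Suc 0) = (1 - a) * s * fps_nth D 0"
  proof -
    have "q * (fps_nth D (Suc 0) - s * fps_nth D 0) + (- (q + a\<^sup>2) * (q * fps_nth D (Suc 0)) + q * a * s * fps_nth D 0)
      + a\<^sup>2 * (q * (q * fps_nth D (Suc 0))) = 0"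
      using arg_cong[OF D, of "\<lambda>F. fps_nth F (Suc 0)"]
      unfolding fps_add_nth cnv fps_nth_quadratic_1 A_def fps_nth_affine_Suc by (simp add: s_def)
    then have "q * ((1 - q) * (1 - a\<^sup>2) * fps_nth D (Suc 0)) = q * ((1 - a) * s * fps_nth D 0)"
      by algebra
    then show ?thesis using assms(3) by (metis mult_left_cancel)
  qed
  have D2: "(1 - q ^ Suc (Suc n)) * (1 - a\<^sup>2 * q ^ Suc n) * fps_nth D (Suc (Suc n))
     = (1 - a * q ^ Suc n) * s * fps_nth D (Suc n) - fps_nth D n" for n
  proof -
    have zi: "z * inverse z = 1" using assms(2) by simp
    have eq: "q * (fps_nth D (Suc (Suc n)) - s * fps_nth D (Suc n) + fps_nth D n)
      + (- (q + a\<^sup>2) * (q ^ Suc (Suc n) * fps_nth D (Suc (Suc n))) + q * a * s * (q ^ Suc n * fps_nth D (Suc n)))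
      + a\<^sup>2 * (q ^ Suc (Suc n) * (q ^ Suc (Suc n) * fps_nth D (Suc (Suc n)))) = 0"
      using arg_cong[OF D, of "\<lambda>F. fps_nth F (Suc (Suc n))"]
      unfolding fps_add_nth cnv fps_nth_quadratic_Suc_Suc A_def fps_nth_affine_Suc zi
      by (simp add: s_def)
    have "q * ((1 - q * y) * (1 - a\<^sup>2 * y) * d2) = q * ((1 - a * y) * s * d1 - d0)"
      if "q * (d2 - s * d1 + d0) + (- (q + a\<^sup>2) * (q * y * d2) + q * a * s * (y * d1)) + a\<^sup>2 * (q * y * (q * y * d2)) = 0"
      for y d0 d1 d2
      using that by algebra
    from this[of "fps_nth D (Suc (Suc n))" "fps_nth D (Suc n)" "fps_nth D n" "q ^ Suc n"] eq
    show ?thesis using assms(3) by simp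
  qed
  have a2: "norm (a\<^sup>2) < 1" using assms(1) by (simp add: norm_power power_less_one_iff)
  have D0: "fps_nth D 0 = 1" by (simp add: D_def E_def V_def ecoef_def qbin_fps_def)
  have "rogers a n z = qfac (a\<^sup>2) n * fps_nth D n"
  proof (induction n rule: nat_less_induct)
    case (1 n)
    consider "n = 0" | "n = Suc 0" | m where "n = Suc (Suc m)" by (metis not0_implies_Suc)
    then show ?case
    proof cases
      case 1
      then show ?thesis by (simp add: rogers_0 D0)
    next
      case 2
      have "(1 - q) * rogers a (Suc 0) z = (1 - q) * (qfac (a\<^sup>2) (Suc 0) * fps_nth D (Suc 0))"
        using rogers_recurrence(1)[OF assms(2), of a] D1 D0 by (simp add: rogers_0 qfac_Suc s_def mult_ac)
      then show ?thesis
        using one_minus_power_nonzero[of 0] by (simp add: 2)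
    next
      case 3
      have "(1 - q ^ Suc (Suc m)) * rogers a (Suc (Suc m)) z =
        (1 - a * q ^ Suc m) * s * rogers a (Suc m) z - (1 - a\<^sup>2 * q ^ m) * rogers a m z"
        unfolding s_def by (rule rogers_recurrence(2)[OF assms(2)])
      also have "\<dots> = (1 - a * q ^ Suc m) * s * (qfac (a\<^sup>2) (Suc m) * fps_nth D (Suc m))
          - (1 - a\<^sup>2 * q ^ m) * (qfac (a\<^sup>2) m * fps_nth D m)"
        using 1 3 by simp
      also have "\<dots> = qfac (a\<^sup>2) (Suc m) * ((1 - a * q ^ Suc m) * s * fps_nth D (Suc m) - fps_nth D m)"
        by (simp add: qfac_Suc algebra_simps)
      also have "\<dots> = (1 - q ^ Suc (Suc m)) * (qfac (a\<^sup>2) (Suc (Suc m)) * fps_nth D (Suc (Suc m)))"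
        unfolding D2[symmetric] qfac_Suc[of "a\<^sup>2" "Suc m"] by (simp only: mult_ac)
      finally show ?thesis
        using one_minus_power_nonzero[of "Suc m"] unfolding 3 by (metis mult_left_cancel)
    qed
  qed
  then show ?thesis by (simp add: D_def E_def V_def)
qed

lemma rogers_cauchy_product:
  assumes "norm a < 1" "z \<noteq> 0" "q \<noteq> 0"
  shows "rogers a n z / qfac (a\<^sup>2) n * t ^ n
    = (\<Sum>k\<le>n. (ecoef a z k * t ^ k) * (qbin 1 0 (n - k) * (z * t) ^ (n - k)))"
proof -
  have "norm (a\<^sup>2) < 1" using assms(1) by (simp add: norm_power power_less_one_iff)
  then have "rogers a n z / qfac (a\<^sup>2) n * t ^ n = (\<Sum>k\<le>n. ecoef a z k * (qbin 1 0 (n - k) * z ^ (n - k)) * t ^ n)"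
    using qfac_nonzero unfolding rogers_eq_fps[OF assms]
    by (simp add: fps_mult_nth qbin_fps_def atMost_atLeast0 sum_distrib_right)
  also have "\<dots> = (\<Sum>k\<le>n. (ecoef a z k * t ^ k) * (qbin 1 0 (n - k) * (z * t) ^ (n - k)))"
  proof (intro sum.cong refl)
    fix k assume "k \<in> {..n}"
    then have "t ^ n = t ^ k * t ^ (n - k)" by (simp flip: power_add)
    then show "ecoef a z k * (qbin 1 0 (n - k) * z ^ (n - k)) * t ^ n
       = (ecoef a z k * t ^ k) * (qbin 1 0 (n - k) * (z * t) ^ (n - k))"
      by (simp add: power_mult_distrib)
  qed
  finally show ?thesis .
qed

lemma ecoef_bounded:
  assumes "norm a < 1"
  obtains B where "B > 0" "\<And>k z. norm z = 1 \<Longrightarrow> norm (ecoef a z k) \<le> B"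
proof -
  have a2: "norm (a\<^sup>2) < 1" using assms(1) by (simp add: norm_power power_less_one_iff)
  obtain K where K: "K > 0" "\<And>n. norm (inverse (qfac q n)) \<le> K"
    using inverse_qfac_bounded[OF norm_q] by blast
  obtain L where L: "L > 0" "\<And>n. norm (inverse (qfac (a\<^sup>2) n)) \<le> L"
    using inverse_qfac_bounded[OF a2] by blast
  define A where "A = exp (norm a / (1 - norm q))"
  show ?thesis
  proof (rule that[of "A * A * (K * L)"])
    show "A * A * (K * L) > 0" using K(1) L(1) by (simp add: A_def)
    fix k and z :: complex assume z: "norm z = 1"
    have "norm (qfac a k) \<le> A" "norm (qfac (a * z\<^sup>2) k) \<le> A"
      using norm_qfac_le[of a k] norm_qfac_le[of "a * z\<^sup>2" k] z by (simp_all add: A_def norm_mult norm_power)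
    then have "norm (qfac a k * qfac (a * z\<^sup>2) k * (inverse (qfac q k) * inverse (qfac (a\<^sup>2) k))) \<le> A * A * (K * L)"
      unfolding norm_mult using K L by (intro mult_mono mult_nonneg_nonneg) (auto simp: A_def)
    moreover have "ecoef a z k = qfac a k * qfac (a * z\<^sup>2) k * (inverse (qfac q k) * inverse (qfac (a\<^sup>2) k)) * inverse z ^ k"
      by (simp add: ecoef_def field_simps)
    ultimately show "norm (ecoef a z k) \<le> A * A * (K * L)"
      using z by (simp add: norm_mult norm_power norm_inverse)
  qed
qed

text \<open>The series \<open>1 / (t z; q)\<^sub>\<infinity>\<close> is expanded by the q-binomial theorem with upper parameter \<open>0\<close>, so
  the claim is the Cauchy product of two absolutely convergent series.\<close>

lemma rogers_generating_function:
  assumes "norm a < 1" "norm z = 1" "q \<noteq> 0" "norm t < 1"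
  shows "(\<lambda>n. rogers a n z / qfac (a\<^sup>2) n * t ^ n) sums
     ((\<Sum>k. ecoef a z k * t ^ k) * (1 / (\<Prod>j. 1 - t * z * q ^ j)))"
proof -
  have z: "z \<noteq> 0" using assms(2) by auto
  have zt: "norm (1 * (z * t)) < 1" using assms by (simp add: norm_mult)
  obtain B where B: "\<And>k. norm (ecoef a z k) \<le> B"
    using ecoef_bounded[OF assms(1)] assms(2) by metis
  have 1: "summable (\<lambda>k. norm (ecoef a z k * t ^ k))"
  proof (rule summable_comparison_test')
    show "summable (\<lambda>k. B * norm t ^ k)"
      using assms(4) by (intro summable_mult summable_geometric) auto
    show "norm (norm (ecoef a z k * t ^ k)) \<le> B * norm t ^ k" for k
      using B[of k] by (simp add: norm_mult norm_power mult_right_mono)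
  qed
  have 2: "summable (\<lambda>k. norm (qbin 1 0 k * (z * t) ^ k))"
    by (rule qbin_summable[OF zt])
  have "(\<Sum>k. qbin 1 0 k * (z * t) ^ k) = 1 / (\<Prod>j. 1 - t * z * q ^ j)"
    using sums_unique[OF q_binomial_theorem[OF zt, of 0]] by (simp add: mult_ac)
  then show ?thesis
    using Cauchy_product_sums[OF 1 2] unfolding rogers_cauchy_product[OF assms(1) z assms(3)] by simp
qed

text \<open>The majorant does not depend on the point of the unit circle; it allows termwise integration.\<close>

lemma rogers_generating_function_majorant:
  assumes "norm a < 1" "q \<noteq> 0" "norm t < 1"
  obtains M where "summable M" "\<And>n z. norm z = 1 \<Longrightarrow> norm (rogers a n z / qfac (a\<^sup>2) n * t ^ n) \<le> M n"
proof -
  obtain B where B: "B > 0" "\<And>k z. norm z = 1 \<Longrightarrow> norm (ecoef a z k) \<le> B"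
    using ecoef_bounded[OF assms(1)] by metis
  obtain K where K: "K > 0" "\<And>n. norm (inverse (qfac q n)) \<le> K"
    using inverse_qfac_bounded[OF norm_q] by blast
  define M where "M n = (\<Sum>k\<le>n. (B * norm t ^ k) * (K * norm t ^ (n - k)))" for n
  show ?thesis
  proof (rule that)
    have s: "summable (\<lambda>k. norm (c * norm t ^ k))" for c :: real
    proof -
      have "summable (\<lambda>k. \<bar>c\<bar> * norm t ^ k)"
        using assms(3) by (intro summable_mult summable_geometric) auto
      then show ?thesis by (simp add: abs_mult)
    qed
    show "summable M"
      unfolding M_def by (rule summable_Cauchy_product[OF s s])
    fix n and z :: complex assume z: "norm z = 1"
    then have nz: "z \<noteq> 0" by auto
    have "norm ((ecoef a z k * t ^ k) * (qbin 1 0 (n - k) * (z * t) ^ (n - k)))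
       \<le> (B * norm t ^ k) * (K * norm t ^ (n - k))" for k
      unfolding norm_mult norm_power using B K(1) K(2)[of "n - k"] z
      by (intro mult_mono mult_nonneg_nonneg) (auto simp: qbin_one_0 norm_divide norm_inverse divide_inverse)
    then show "norm (rogers a n z / qfac (a\<^sup>2) n * t ^ n) \<le> M n"
      unfolding rogers_cauchy_product[OF assms(1) nz assms(2)] M_def by (intro sum_norm_le)
  qed
qed

end

section \<open>Mixed moments\<close>

context rogers_parameter
begin

lemma weight_int_lincomb:
  assumes "continuous_on {-pi..pi} f" "continuous_on {-pi..pi} h"
  shows "weight_int (\<lambda>x. c * f x + d * h x) = c * weight_int f + d * weight_int h"
proof -
  have "(\<lambda>x. (c * f x + d * h x) * weight x) = (\<lambda>x. c * (f x * weight x) + d * (h x * weight x))"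
    by (simp add: algebra_simps)
  then show ?thesis
    unfolding weight_int_def
    by (simp only:) (subst integral_add,
      auto intro!: integrable_continuous_real continuous_intros continuous_on_weight assms)
qed

definition mixed_moment :: "complex \<Rightarrow> nat \<Rightarrow> nat \<Rightarrow> complex" where
  "mixed_moment b m n = weight_int (\<lambda>x. rogers b m (cis x) * rogers g n (cis x))"

text \<open>The value of the mixed moment with indices \<open>n + 2 k\<close> and \<open>n\<close>. The constant is \<open>4 \<pi>\<close> because the
  integration is over the full circle.\<close>

definition mixed_moment_val :: "complex \<Rightarrow> nat \<Rightarrow> nat \<Rightarrow> complex" where
  "mixed_moment_val b n k = 4 * of_real pi * hcoef 0 * (\<Prod>i<k. g - b * q ^ i) * qfac b (n + k) * qfac (g\<^sup>2) n /
     (qfac q k * qfac (q * g) (n + k) * qfac q n)"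

lemma one_minus_g_power_nonzero: "1 - g * q ^ j \<noteq> 0"
  by (rule one_minus_nonzero[OF norm_g])

lemma qfac_qg_nonzero: "qfac (q * g) n \<noteq> 0"
  unfolding qfac_def prod_zero_iff[OF finite_lessThan]
  using one_minus_g_power_nonzero[of "Suc j" for j] by (auto simp: mult_ac)

lemma mixed_moment_val_Suc_right:
  "(1 - q ^ Suc k) * (1 - g * q ^ Suc (n + k)) * mixed_moment_val b n (Suc k)
     = (g - b * q ^ k) * (1 - b * q ^ (n + k)) * mixed_moment_val b n k"
  and mixed_moment_val_Suc_left:
  "(1 - q ^ Suc n) * (1 - g * q ^ Suc (n + k)) * mixed_moment_val b (Suc n) k
     = (1 - b * q ^ (n + k)) * (1 - g\<^sup>2 * q ^ n) * mixed_moment_val b n k"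
proof -
  have nz: "qfac q n \<noteq> 0" "qfac q k \<noteq> 0" "qfac (q * g) (n + k) \<noteq> 0" "1 - q ^ Suc k \<noteq> 0" "1 - q ^ Suc n \<noteq> 0"
    "1 - g * q ^ Suc (n + k) \<noteq> 0"
    using qfac_nonzero[OF norm_q] qfac_qg_nonzero one_minus_power_nonzero one_minus_g_power_nonzero by blast+
  have S: "qfac q (Suc j) = qfac q j * (1 - q ^ Suc j)" "qfac (q * g) (Suc j) = qfac (q * g) j * (1 - g * q ^ Suc j)" for j
    by (simp_all add: qfac_Suc mult_ac)
  show "(1 - q ^ Suc k) * (1 - g * q ^ Suc (n + k)) * mixed_moment_val b n (Suc k)
     = (g - b * q ^ k) * (1 - b * q ^ (n + k)) * mixed_moment_val b n k"
    using nz unfolding mixed_moment_val_def add_Suc_right S qfac_Suc[of b] prod.lessThan_Suc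
    by (simp add: divide_simps del: power_Suc)
  show "(1 - q ^ Suc n) * (1 - g * q ^ Suc (n + k)) * mixed_moment_val b (Suc n) k
     = (1 - b * q ^ (n + k)) * (1 - g\<^sup>2 * q ^ n) * mixed_moment_val b n k"
    using nz unfolding mixed_moment_val_def add_Suc S qfac_Suc[of b] qfac_Suc[of "g\<^sup>2"]
    by (simp add: divide_simps del: power_Suc)
qed

text \<open>By the two first-order recurrences above, both sides are rational multiples of
  \<open>mixed_moment_val b (Suc n) k\<close>; it remains to check a polynomial identity in \<open>q\<^sup>n\<close> and \<open>q\<^sup>k\<close>.\<close>

lemma mixed_moment_val_recurrence:
  fixes n k :: nat
  defines "m \<equiv> Suc n + 2 * k"
  shows "(1 - g * q ^ Suc n) * (1 - q ^ Suc (Suc m)) * mixed_moment_val b (Suc n) (Suc k)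
    = (1 - b * q ^ Suc m) * ((1 - q ^ Suc (Suc n)) * mixed_moment_val b (Suc (Suc n)) k
        + (1 - g\<^sup>2 * q ^ n) * mixed_moment_val b n (Suc k))
      - (1 - g * q ^ Suc n) * (1 - b\<^sup>2 * q ^ m) * mixed_moment_val b (Suc n) k"
proof -
  define A K where "A = q ^ n" and "K = q ^ k"
  define v v1 v2 w w1 where "v = mixed_moment_val b n k" and "v1 = mixed_moment_val b (Suc n) k"
    and "v2 = mixed_moment_val b (Suc (Suc n)) k" and "w = mixed_moment_val b n (Suc k)"
    and "w1 = mixed_moment_val b (Suc n) (Suc k)"
  have b: "(1 - q * A) * (1 - g * q * A * K) * v1 = (1 - b * A * K) * (1 - g\<^sup>2 * A) * v"
    using mixed_moment_val_Suc_left[of n k b] by (simp add: A_def K_def v_def v1_def power_add mult_ac)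
  have b': "(1 - q\<^sup>2 * A) * (1 - g * q\<^sup>2 * A * K) * v2 = (1 - b * q * A * K) * (1 - g\<^sup>2 * q * A) * v1"
    using mixed_moment_val_Suc_left[of "Suc n" k b] by (simp add: A_def K_def v1_def v2_def power_add power2_eq_square mult_ac)
  have a: "(1 - q * K) * (1 - g * q * A * K) * w = (g - b * K) * (1 - b * A * K) * v"
    using mixed_moment_val_Suc_right[of k n b] by (simp add: A_def K_def v_def w_def power_add mult_ac)
  have a': "(1 - q * K) * (1 - g * q\<^sup>2 * A * K) * w1 = (g - b * K) * (1 - b * q * A * K) * v1"
    using mixed_moment_val_Suc_right[of k "Suc n" b] by (simp add: A_def K_def v1_def w1_def power_add power2_eq_square mult_ac)
  have nz: "1 - q * K \<noteq> 0" "1 - g * q * A * K \<noteq> 0" "1 - g * q\<^sup>2 * A * K \<noteq> 0"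
    using one_minus_power_nonzero[of k] one_minus_g_power_nonzero[of "Suc (n + k)"] one_minus_g_power_nonzero[of "Suc (Suc (n + k))"]
    by (simp_all add: A_def K_def power_add power2_eq_square mult_ac)
  have "(1 - g * q * A * K) * ((1 - q * K) * (1 - g\<^sup>2 * A) * w) = (1 - g * q * A * K) * ((g - b * K) * (1 - q * A) * v1)"
    using a b by algebra
  then have w: "(1 - q * K) * (1 - g\<^sup>2 * A) * w = (g - b * K) * (1 - q * A) * v1"
    using nz by (metis mult_left_cancel)
  define lhs rhs where "lhs = (1 - g * (q * A)) * (1 - q\<^sup>2 * (q * A * K\<^sup>2)) * w1"
    and "rhs = (1 - b * (q * (q * A * K\<^sup>2))) * ((1 - q\<^sup>2 * A) * v2 + (1 - g\<^sup>2 * A) * w)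
      - (1 - g * (q * A)) * (1 - b\<^sup>2 * (q * A * K\<^sup>2)) * v1"
  have "((1 - q * K) * (1 - g * q\<^sup>2 * A * K)) * lhs = ((1 - q * K) * (1 - g * q\<^sup>2 * A * K)) * rhs"
    unfolding lhs_def rhs_def using a' b' w by algebra
  then have "lhs = rhs"
    using nz by (metis mult_left_cancel mult_eq_0_iff)
  moreover have "q ^ m = q * A * K\<^sup>2"
    by (simp add: m_def A_def K_def power_add power_mult mult.commute power2_eq_square power_mult_distrib)
  ultimately show ?thesis
    by (simp add: lhs_def rhs_def A_def v1_def v2_def w_def w1_def power2_eq_square mult_ac)
qed

lemma mixed_moment_val_recurrence_0:
  fixes k :: nat
  defines "m \<equiv> 2 * k"
  shows "(1 - g) * (1 - q ^ Suc (Suc m)) * mixed_moment_val b 0 (Suc k)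
    = (1 - b * q ^ Suc m) * ((1 - q) * mixed_moment_val b (Suc 0) k)
      - (1 - g) * (1 - b\<^sup>2 * q ^ m) * mixed_moment_val b 0 k"
proof -
  define K where "K = q ^ k"
  define v v1 w where "v = mixed_moment_val b 0 k" and "v1 = mixed_moment_val b (Suc 0) k"
    and "w = mixed_moment_val b 0 (Suc k)"
  have b: "(1 - q) * (1 - g * q * K) * v1 = (1 - b * K) * (1 - g\<^sup>2) * v"
    using mixed_moment_val_Suc_left[of 0 k b] by (simp add: K_def v_def v1_def mult_ac)
  have a: "(1 - q * K) * (1 - g * q * K) * w = (g - b * K) * (1 - b * K) * v"
    using mixed_moment_val_Suc_right[of k 0 b] by (simp add: K_def v_def w_def mult_ac)
  have nz: "1 - q * K \<noteq> 0" "1 - g * q * K \<noteq> 0"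
    using one_minus_power_nonzero[of k] one_minus_g_power_nonzero[of "Suc k"]
    by (simp_all add: K_def mult_ac)
  define lhs rhs where "lhs = (1 - g) * (1 - q\<^sup>2 * K\<^sup>2) * w"
    and "rhs = (1 - b * (q * K\<^sup>2)) * ((1 - q) * v1) - (1 - g) * (1 - b\<^sup>2 * K\<^sup>2) * v"
  have "((1 - q * K) * (1 - g * q * K)) * lhs = ((1 - q * K) * (1 - g * q * K)) * rhs"
    unfolding lhs_def rhs_def using a b by algebra
  then have "lhs = rhs"
    using nz by (metis mult_left_cancel mult_eq_0_iff)
  moreover have "q ^ m = K\<^sup>2"
    by (simp add: m_def K_def power_mult mult.commute power_mult_distrib power2_eq_square power_add mult_2)
  ultimately show ?thesis
    by (simp add: lhs_def rhs_def v_def v1_def w_def power2_eq_square mult_ac)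
qed

lemma mixed_moment_0: "mixed_moment b 0 n = (if n = 0 then 4 * of_real pi * hcoef 0 else 0)"
  unfolding mixed_moment_def rogers_0 using weight_int_rogers[of n] by simp

text \<open>The mixed moment with an additional factor \<open>2 cos \<theta>\<close>, which can be absorbed by either polynomial.\<close>

definition mixed_moment_cos :: "complex \<Rightarrow> nat \<Rightarrow> nat \<Rightarrow> complex" where
  "mixed_moment_cos b m n = weight_int (\<lambda>x. (cis x + inverse (cis x)) * (rogers b m (cis x) * rogers g n (cis x)))"

lemma continuous_on_inverse_cis: "continuous_on S (\<lambda>x. inverse (cis x))"
  by (intro continuous_intros) auto

lemma mixed_moment_eqI:
  assumes "\<And>x. c * F x = d * G x + e * H x"
    and "continuous_on {-pi..pi} F" "continuous_on {-pi..pi} G" "continuous_on {-pi..pi} H"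
  shows "c * weight_int F = d * weight_int G + e * weight_int H"
proof -
  have "weight_int (\<lambda>x. c * F x + 0 * F x) = weight_int (\<lambda>x. d * G x + e * H x)"
    using assms(1) by simp
  then show ?thesis
    unfolding weight_int_lincomb[OF assms(2,2)] weight_int_lincomb[OF assms(3,4)] by simp
qed

lemma mixed_moment_left_1: "(1 - q) * mixed_moment b (Suc 0) n = (1 - b) * mixed_moment_cos b 0 n"
proof -
  have "(1 - q) * mixed_moment b (Suc 0) n = (1 - b) * mixed_moment_cos b 0 n + 0 * mixed_moment b 0 n"
    unfolding mixed_moment_def mixed_moment_cos_def
  proof (rule mixed_moment_eqI)
    fix x
    show "(1 - q) * (rogers b (Suc 0) (cis x) * rogers g n (cis x))
      = (1 - b) * ((cis x + inverse (cis x)) * (rogers b 0 (cis x) * rogers g n (cis x))) + 0 * (rogers b 0 (cis x) * rogers g n (cis x))"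
      using rogers_recurrence(1)[OF cis_neq_zero, of b x] by (simp add: mult.assoc[symmetric])
  qed (intro continuous_intros continuous_on_inverse_cis)+
  then show ?thesis by simp
qed

lemma mixed_moment_left_Suc: "(1 - q ^ Suc (Suc m)) * mixed_moment b (Suc (Suc m)) n
   = (1 - b * q ^ Suc m) * mixed_moment_cos b (Suc m) n + (- (1 - b\<^sup>2 * q ^ m)) * mixed_moment b m n"
  unfolding mixed_moment_def mixed_moment_cos_def
proof (rule mixed_moment_eqI)
  fix x
  have "D * (r2 * R) = C * (s * (r1 * R)) + (- E) * (r0 * R)" if "D * r2 = C * s * r1 - E * r0"
    for C D E R s r0 r1 r2 :: complex
    using that by algebra
  from this[OF rogers_recurrence(2)[OF cis_neq_zero]]
  show "(1 - q ^ Suc (Suc m)) * (rogers b (Suc (Suc m)) (cis x) * rogers g n (cis x))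
    = (1 - b * q ^ Suc m) * ((cis x + inverse (cis x)) * (rogers b (Suc m) (cis x) * rogers g n (cis x)))
      + (- (1 - b\<^sup>2 * q ^ m)) * (rogers b m (cis x) * rogers g n (cis x))" .
qed (intro continuous_intros continuous_on_inverse_cis)+

lemma mixed_moment_right_0: "(1 - g) * mixed_moment_cos b m 0 = (1 - q) * mixed_moment b m (Suc 0)"
proof -
  have "(1 - g) * mixed_moment_cos b m 0 = (1 - q) * mixed_moment b m (Suc 0) + 0 * mixed_moment b m 0"
    unfolding mixed_moment_def mixed_moment_cos_def
  proof (rule mixed_moment_eqI)
    fix x
    show "(1 - g) * ((cis x + inverse (cis x)) * (rogers b m (cis x) * rogers g 0 (cis x)))
      = (1 - q) * (rogers b m (cis x) * rogers g (Suc 0) (cis x)) + 0 * (rogers b m (cis x) * rogers g 0 (cis x))"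
      using rogers_recurrence(1)[OF cis_neq_zero, of g x] by (simp add: mult.left_commute[of _ "rogers b m (cis x)"] mult.assoc)
  qed (intro continuous_intros continuous_on_inverse_cis)+
  then show ?thesis by simp
qed

lemma mixed_moment_right_Suc: "(1 - g * q ^ Suc n) * mixed_moment_cos b m (Suc n)
   = (1 - q ^ Suc (Suc n)) * mixed_moment b m (Suc (Suc n)) + (1 - g\<^sup>2 * q ^ n) * mixed_moment b m n"
  unfolding mixed_moment_def mixed_moment_cos_def
proof (rule mixed_moment_eqI)
  fix x
  have "C * (s * (R * r1)) = D * (R * r2) + E * (R * r0)" if "D * r2 = C * s * r1 - E * r0"
    for C D E R s r0 r1 r2 :: complex
    using that by algebra
  from this[OF rogers_recurrence(2)[OF cis_neq_zero]]
  show "(1 - g * q ^ Suc n) * ((cis x + inverse (cis x)) * (rogers b m (cis x) * rogers g (Suc n) (cis x)))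
    = (1 - q ^ Suc (Suc n)) * (rogers b m (cis x) * rogers g (Suc (Suc n)) (cis x))
      + (1 - g\<^sup>2 * q ^ n) * (rogers b m (cis x) * rogers g n (cis x))" .
qed (intro continuous_intros continuous_on_inverse_cis)+

text \<open>Eliminating \<open>mixed_moment_cos\<close> between the recurrences in the two indices expresses the moments
  with first index \<open>m + 2\<close> by those with \<open>m + 1\<close> and \<open>m\<close>. On the diagonal \<open>m + 2 = n\<close> only one term
  survives; for \<open>m + 2 = n + 2 k\<close> with \<open>k \<ge> 1\<close> the closed form satisfies the same recurrence; in all other
  cases every term vanishes.\<close>

lemma mixed_moment_eq:
  "mixed_moment b m n = (if n \<le> m \<and> even (m - n) then mixed_moment_val b n ((m - n) div 2) else 0)"
proof (induction m arbitrary: n rule: less_induct)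
  case (less m)
  have qnz: "1 - q ^ Suc j \<noteq> 0" for j by (rule one_minus_power_nonzero)
  have gnz: "1 - g * q ^ j \<noteq> 0" for j by (rule one_minus_g_power_nonzero)
  have g1: "1 - g \<noteq> 0" using gnz[of 0] by simp
  consider "m = 0" | "m = Suc 0" | m' where "m = Suc (Suc m')" by (metis not0_implies_Suc)
  then show ?case
  proof cases
    case 1
    then show ?thesis by (auto simp: mixed_moment_0 mixed_moment_val_def)
  next
    case 2
    note M0 = mixed_moment_0[of b]
    show ?thesis
    proof (cases n)
      case 0
      have "(1 - g) * ((1 - q) * mixed_moment b (Suc 0) 0) = (1 - b) * ((1 - g) * mixed_moment_cos b 0 0)"
        unfolding mixed_moment_left_1 by simp
      then have "(1 - g) * ((1 - q) * mixed_moment b (Suc 0) 0) = 0"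
        unfolding mixed_moment_right_0 M0 by simp
      then show ?thesis using 2 0 g1 qnz[of 0] by simp
    next
      case (Suc l)
      have "(1 - g * q ^ Suc l) * ((1 - q) * mixed_moment b (Suc 0) (Suc l))
         = (1 - b) * ((1 - g * q ^ Suc l) * mixed_moment_cos b 0 (Suc l))"
        unfolding mixed_moment_left_1 by simp
      then have *: "(1 - g * q ^ Suc l) * ((1 - q) * mixed_moment b (Suc 0) (Suc l))
         = (1 - b) * (1 - g\<^sup>2 * q ^ l) * (if l = 0 then mixed_moment_val b 0 0 else 0)"
        unfolding mixed_moment_right_Suc M0 by (simp add: mixed_moment_val_def)
      show ?thesis
      proof (cases "l = 0")
        case True
        have "(1 - q) * (1 - g * q) * mixed_moment b (Suc 0) (Suc 0) = (1 - q) * (1 - g * q) * mixed_moment_val b (Suc 0) 0"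
          using * mixed_moment_val_Suc_left[of 0 0 b] True by (simp add: mult_ac)
        then show ?thesis using 2 Suc True gnz[of 1] qnz[of 0] by simp
      next
        case False
        then show ?thesis using * 2 Suc gnz[of "Suc l"] qnz[of 0] by simp
      qed
    qed
  next
    case 3
    define V where "V m n = (if n \<le> m \<and> even (m - n) then mixed_moment_val b n ((m - n) div 2) else 0)" for m n
    have IH: "mixed_moment b m' j = V m' j" "mixed_moment b (Suc m') j = V (Suc m') j" for j
      unfolding V_def by (rule less; simp add: 3)+
    have V1: "V (j + 2 * k) j = mixed_moment_val b j k" for j k
      by (simp add: V_def)
    have V0: "V i j = 0" if "\<And>k. i \<noteq> j + 2 * k" for i j
    proof -
      have "\<not> (j \<le> i \<and> even (i - j))"
      proof
        assume "j \<le> i \<and> even (i - j)"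
        then obtain k where "i - j = 2 * k" by (meson evenE)
        with \<open>j \<le> i \<and> even (i - j)\<close> have "i = j + 2 * k" by simp
        with that show False by blast
      qed
      then show ?thesis unfolding V_def by (rule if_not_P)
    qed
    have lin: "X * (C * S + - E * R) = C * (X * S) - X * E * R" for X C S E R :: complex
      by (simp add: algebra_simps)
    \<comment> \<open>For n = 0 the recurrence in n has no lower neighbour.\<close>
    have "mixed_moment b (Suc (Suc m')) n = V (Suc (Suc m')) n"
    proof (cases n)
      case 0
      have "(1 - g) * ((1 - q ^ Suc (Suc m')) * mixed_moment b (Suc (Suc m')) 0)
         = (1 - b * q ^ Suc m') * ((1 - g) * mixed_moment_cos b (Suc m') 0)
           - (1 - g) * (1 - b\<^sup>2 * q ^ m') * mixed_moment b m' 0"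
        unfolding mixed_moment_left_Suc by (rule lin)
      then have *: "(1 - g) * (1 - q ^ Suc (Suc m')) * mixed_moment b (Suc (Suc m')) 0
         = (1 - b * q ^ Suc m') * ((1 - q) * V (Suc m') (Suc 0)) - (1 - g) * (1 - b\<^sup>2 * q ^ m') * V m' 0"
        unfolding mixed_moment_right_0 IH by (simp only: mult.assoc)
      show ?thesis
      proof (cases "even m'")
        case True
        then obtain k where k: "m' = 2 * k" by (elim evenE)
        have "V (Suc m') (Suc 0) = mixed_moment_val b (Suc 0) k" "V m' 0 = mixed_moment_val b 0 k"
          "V (Suc (Suc m')) 0 = mixed_moment_val b 0 (Suc k)"
          using V1[of "Suc 0" k] V1[of 0 k] V1[of 0 "Suc k"] by (simp_all add: k)
        with * mixed_moment_val_recurrence_0[of k b]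
        have "(1 - g) * (1 - q ^ Suc (Suc m')) * mixed_moment b (Suc (Suc m')) 0
           = (1 - g) * (1 - q ^ Suc (Suc m')) * V (Suc (Suc m')) 0"
          by (simp only: k)
        then show ?thesis using 0 g1 qnz[of "Suc m'"] by (metis mult_left_cancel mult_eq_0_iff)
      next
        case False
        have "V (Suc m') (Suc 0) = 0" "V m' 0 = 0" "V (Suc (Suc m')) 0 = 0"
          using False by (simp_all add: V_def)
        with * show ?thesis using 0 g1 qnz[of "Suc m'"] by simp
      qed
    next
      case (Suc l)
      have "(1 - g * q ^ Suc l) * ((1 - q ^ Suc (Suc m')) * mixed_moment b (Suc (Suc m')) (Suc l))
         = (1 - b * q ^ Suc m') * ((1 - g * q ^ Suc l) * mixed_moment_cos b (Suc m') (Suc l))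
           - (1 - g * q ^ Suc l) * (1 - b\<^sup>2 * q ^ m') * mixed_moment b m' (Suc l)"
        unfolding mixed_moment_left_Suc by (rule lin)
      then have *: "(1 - g * q ^ Suc l) * (1 - q ^ Suc (Suc m')) * mixed_moment b (Suc (Suc m')) (Suc l)
         = (1 - b * q ^ Suc m') * ((1 - q ^ Suc (Suc l)) * V (Suc m') (Suc (Suc l)) + (1 - g\<^sup>2 * q ^ l) * V (Suc m') l)
           - (1 - g * q ^ Suc l) * (1 - b\<^sup>2 * q ^ m') * V m' (Suc l)"
        unfolding mixed_moment_right_Suc IH by (simp only: mult.assoc)
      have nz: "(1 - g * q ^ Suc l) * (1 - q ^ Suc (Suc m')) \<noteq> 0"
        using gnz qnz by (metis mult_eq_0_iff)
      consider (diag) "Suc m' = l" | (below) k where "m' = Suc l + 2 * k" | (none) "\<And>k. Suc m' \<noteq> l + 2 * k"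
      proof (cases "\<exists>k. Suc m' = l + 2 * k")
        case True
        then obtain k where k: "Suc m' = l + 2 * k" by blast
        show ?thesis
        proof (cases k)
          case 0
          with k diag show ?thesis by simp
        next
          case (Suc j)
          with k below[of j] show ?thesis by simp
        qed
      qed (use none in blast)
      then have "(1 - g * q ^ Suc l) * (1 - q ^ Suc (Suc m')) * mixed_moment b (Suc (Suc m')) (Suc l)
         = (1 - g * q ^ Suc l) * (1 - q ^ Suc (Suc m')) * V (Suc (Suc m')) (Suc l)"
      proof cases
        case diag
        have "V (Suc m') (Suc (Suc l)) = 0" "V m' (Suc l) = 0" using diag by (simp_all add: V_def)
        moreover have "V (Suc m') l = mixed_moment_val b l 0" "V (Suc (Suc m')) (Suc l) = mixed_moment_val b (Suc l) 0"
          using V1[of l 0] V1[of "Suc l" 0] diag by simp_all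
        ultimately show ?thesis
          using * mixed_moment_val_Suc_left[of l 0 b] diag by (simp add: mult_ac)
      next
        case below
        have "V (Suc m') (Suc (Suc l)) = mixed_moment_val b (Suc (Suc l)) k"
          "V (Suc m') l = mixed_moment_val b l (Suc k)" "V m' (Suc l) = mixed_moment_val b (Suc l) k"
          "V (Suc (Suc m')) (Suc l) = mixed_moment_val b (Suc l) (Suc k)"
          using V1[of "Suc (Suc l)" k] V1[of l "Suc k"] V1[of "Suc l" k] V1[of "Suc l" "Suc k"]
          by (simp_all add: below)
        with * mixed_moment_val_recurrence[of l k b] show ?thesis by (simp only: below)
      next
        case none
        have "V (Suc m') (Suc (Suc l)) = 0"
        proof (rule V0)
          fix k show "Suc m' \<noteq> Suc (Suc l) + 2 * k" using none[of "Suc k"] by simp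
        qed
        moreover have "V (Suc m') l = 0" using none by (rule V0)
        moreover have "V m' (Suc l) = 0"
        proof (rule V0)
          fix k show "m' \<noteq> Suc l + 2 * k" using none[of "Suc k"] by simp
        qed
        moreover have "V (Suc (Suc m')) (Suc l) = 0"
        proof (rule V0)
          fix k show "Suc (Suc m') \<noteq> Suc l + 2 * k" using none[of k] by simp
        qed
        ultimately show ?thesis using * by simp
      qed
      then show ?thesis using nz Suc by (metis mult_left_cancel)
    qed
    then show ?thesis unfolding 3 V_def .
  qed
qed

end

section \<open>The integral\<close>

text \<open>A primitive of \<open>f\<close> composed with \<open>arccos\<close> is continuous on the closed interval and differentiable
  inside, so the fundamental theorem of calculus applies although the integrand may be unbounded at
  the end points.\<close>

lemma has_integral_arccos_substitution:
  fixes f :: "real \<Rightarrow> complex"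
  assumes "continuous_on {0..pi} f"
  shows "((\<lambda>x. f (arccos x) * of_real (1 / sqrt (1 - x\<^sup>2))) has_integral integral {0..pi} f) {-1<..<1}"
proof -
  define \<Phi> where "\<Phi> y = integral {0..y} f" for y
  have "((\<lambda>x. f (arccos x) * of_real (1 / sqrt (1 - x\<^sup>2))) has_integral ((- (\<Phi> \<circ> arccos)) 1 - (- (\<Phi> \<circ> arccos)) (-1))) {-1..1}"
  proof (rule fundamental_theorem_of_calculus_interior)
    have "continuous_on {0..pi} \<Phi>"
      unfolding \<Phi>_def using assms by (intro indefinite_integral_continuous_1 integrable_continuous_real)
    then show "continuous_on {-1..1} (- (\<Phi> \<circ> arccos))"
      unfolding fun_Compl_def
      by (intro continuous_on_minus continuous_on_compose continuous_on_arccos')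
        (auto elim!: continuous_on_subset intro: arccos_lbound arccos_ubound)
    fix x :: real assume x: "x \<in> {-1<..<1}"
    have "arccos x \<in> {0<..<pi}" using arccos_lt_bounded[of x] x by auto
    then have "(\<Phi> has_vector_derivative f (arccos x)) (at (arccos x))"
      using integral_has_vector_derivative[OF assms, of "arccos x"] unfolding \<Phi>_def
      by (metis at_within_Icc_at greaterThanLessThan_iff atLeastAtMost_iff less_imp_le)
    moreover have "(arccos has_vector_derivative - (1 / sqrt (1 - x\<^sup>2))) (at x)"
      using DERIV_arccos[of x] x by (simp add: has_real_derivative_iff_has_vector_derivative divide_inverse)
    ultimately have "((\<Phi> \<circ> arccos) has_vector_derivative (- (1 / sqrt (1 - x\<^sup>2))) *\<^sub>R f (arccos x)) (at x)"
      by (intro vector_diff_chain_at)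
    from has_vector_derivative_minus[OF this]
    show "(- (\<Phi> \<circ> arccos) has_vector_derivative f (arccos x) * of_real (1 / sqrt (1 - x\<^sup>2))) (at x)"
      by (simp add: fun_Compl_def scaleR_conv_of_real mult.commute)
  qed simp
  then show ?thesis
    by (simp add: has_integral_Icc_iff_Ioo \<Phi>_def)
qed

lemma integral_even_half:
  fixes f :: "real \<Rightarrow> complex"
  assumes "continuous_on {-c..c} f" "\<And>x. f (- x) = f x" "c \<ge> 0"
  shows "integral {-c..c} f = 2 * integral {0..c} f"
proof -
  have int: "f integrable_on {-c..c}"
    using assms(1) by (rule integrable_continuous_real)
  have "(f has_integral integral {0..c} f) {0..c}"
    using int assms(3) by (intro integrable_integral) (auto elim: integrable_subinterval_real)
  then have "((\<lambda>x. f (- x)) has_integral integral {0..c} f) {-c..-0}"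
    by (subst has_integral_reflect_real)
  then have "integral {-c..0} f = integral {0..c} f"
    using assms(2) by (simp add: integral_unique)
  then show ?thesis
    using Henstock_Kurzweil_Integration.integral_combine[of "-c" 0 c f] int assms(3) by simp
qed

context q_base
begin

lemma qpoch_eq: "qpoch as q n = (\<Prod>a\<leftarrow>as. qfac a n)"
  by (simp add: qpoch_def qfac_def)

lemma rogers_inverse: "rogers a n (inverse z) = rogers a n z"
  by (metis rogers_fps mult.commute inverse_inverse_eq)

lemma qfac_add: "qfac a (n + k) = qfac a n * qfac (a * q ^ n) k"
  by (induction k) (simp_all add: qfac_Suc power_add mult_ac)

text \<open>The factors of \<open>(c; q)\<^sub>2\<^sub>k\<close> with even index are \<open>1 - x\<^sup>2 q\<^sup>2\<^sup>j\<close>, those with odd index \<open>1 - y\<^sup>2 q\<^sup>2\<^sup>j\<close>.\<close>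

lemma qfac_double:
  assumes "x\<^sup>2 = c" "y\<^sup>2 = c * q"
  shows "qfac c (2 * k) = qfac x k * qfac (- x) k * qfac y k * qfac (- y) k"
proof (induction k)
  case (Suc k)
  have "qfac c (2 * Suc k) = qfac c (2 * k) * (1 - c * (q ^ k)\<^sup>2) * (1 - c * q * (q ^ k)\<^sup>2)"
    by (simp add: qfac_Suc power_mult[symmetric] mult_ac)
  also have "1 - c * (q ^ k)\<^sup>2 = (1 - x * q ^ k) * (1 - (- x) * q ^ k)"
    unfolding assms(1)[symmetric] by (simp add: algebra_simps power2_eq_square)
  also have "1 - c * q * (q ^ k)\<^sup>2 = (1 - y * q ^ k) * (1 - (- y) * q ^ k)"
    unfolding assms(2)[symmetric] by (simp add: algebra_simps power2_eq_square)
  finally show ?case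
    unfolding Suc qfac_Suc by (simp only: mult_ac)
qed simp

lemma qfac_reversed:
  assumes "norm g < 1" "g \<noteq> 0" "q \<noteq> 0" "k \<le> n"
  shows "qfac g n / qfac q n * (qfac (q powi (- int n)) k / qfac (inverse g * q powi (1 - int n)) k * (q * inverse g) ^ k)
     = qfac g (n - k) / qfac q (n - k)"
  using assms(4)
proof (induction k)
  case (Suc k)
  define d where "d = n - Suc k"
  have n: "n - k = Suc d" "n = Suc (d + k)" using Suc.prems by (auto simp: d_def)
  have pw: "q powi (- int n) * q ^ k = inverse (q * q ^ d)" "q powi (1 - int n) * q ^ k = inverse (q ^ d)"
  proof -
    have "1 - int n = - int (d + k)" by (simp add: n)
    then have "q powi (1 - int n) = inverse (q ^ (d + k))" "q powi (- int n) = inverse (q ^ n)"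
      by (simp_all only: power_int_minus power_int_of_nat)
    then show "q powi (- int n) * q ^ k = inverse (q * q ^ d)" "q powi (1 - int n) * q ^ k = inverse (q ^ d)"
      using assms(3) by (simp_all add: n(2) power_add field_simps)
  qed
  define X Y where "X = qfac (q powi (- int n)) k" and "Y = qfac (inverse g * q powi (1 - int n)) k"
  have nz: "1 - g * q ^ d \<noteq> 0" "1 - q * q ^ d \<noteq> 0"
    using one_minus_nonzero[OF assms(1)] one_minus_nonzero[OF norm_q] by auto
  have "qfac g n / qfac q n * (qfac (q powi (- int n)) (Suc k) / qfac (inverse g * q powi (1 - int n)) (Suc k) * (q * inverse g) ^ Suc k)
    = qfac g n / qfac q n * (X / Y * (q * inverse g) ^ k) * ((1 - inverse (q * q ^ d)) / (1 - inverse g * inverse (q ^ d)) * (q * inverse g))"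
    unfolding qfac_Suc mult.assoc pw by (simp add: X_def Y_def)
  also have "(1 - inverse (q * q ^ d)) / (1 - inverse g * inverse (q ^ d)) * (q * inverse g) = (1 - q * q ^ d) / (1 - g * q ^ d)"
  proof -
    have "1 - inverse (q * q ^ d) = (1 - q * q ^ d) * - inverse (q * q ^ d)"
      "1 - inverse g * inverse (q ^ d) = (1 - g * q ^ d) * - inverse (g * q ^ d)"
      using assms by (simp_all add: field_simps)
    moreover have "X * - inverse (q * y) / (Y * - inverse (g * y)) * (q * inverse g) = X / Y" if "y \<noteq> 0" for X Y y
      using that assms(2,3) by (simp add: field_simps)
    ultimately show ?thesis using assms(3) by simp
  qed
  also have "qfac g n / qfac q n * (X / Y * (q * inverse g) ^ k) = qfac g (Suc d) / qfac q (Suc d)"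
    using Suc n by (simp add: X_def Y_def)
  also have "qfac g (Suc d) / qfac q (Suc d) * ((1 - q * q ^ d) / (1 - g * q ^ d)) = qfac g d / qfac q d"
    using nz by (simp add: qfac_Suc)
  finally show ?case by (simp add: d_def)
qed simp

text \<open>Reversing the order of the factors of \<open>(g; q)\<^sub>n\<close> and \<open>(q; q)\<^sub>n\<close> turns the terminating \<open>\<^sub>2\<phi>\<^sub>1\<close> into the
  Fourier expansion; the terms with \<open>k > n\<close> vanish because of the factor \<open>1 - q\<^sup>-\<^sup>n q\<^sup>n\<close>.\<close>

lemma rogers_eq_qhyp:
  assumes "norm g < 1" "g \<noteq> 0" "q \<noteq> 0"
  shows "qpoch [g] q n / qpoch [q] q n * cis (real n * \<theta>) *
       qhyp [q powi (- int n), g] [inverse g * q powi (1 - int n)] q (q * inverse g * cis (- 2 * \<theta>))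
     = rogers g n (cis \<theta>)"
proof -
  let ?a = "q powi (- int n)" and ?c = "inverse g * q powi (1 - int n)"
  define T where "T k = qfac ?a k * qfac g k / (qfac q k * qfac ?c k) * (q * inverse g * cis (- 2 * \<theta>)) ^ k" for k
  have T0: "T k = 0" if "k \<notin> {..n}" for k
  proof -
    have "1 - ?a * q ^ n = 0" using assms(3) by (simp add: power_int_minus)
    then have "qfac ?a k = 0"
      using that unfolding qfac_def by (intro prod_zero) auto
    then show ?thesis by (simp add: T_def)
  qed
  have "qhyp [?a, g] [?c] q (q * inverse g * cis (- 2 * \<theta>)) = (\<Sum>k\<le>n. T k)"
    unfolding qhyp_def qpoch_eq using suminf_finite[OF finite_atMost T0]
    by (simp add: T_def)
  then have "qpoch [g] q n / qpoch [q] q n * cis (real n * \<theta>) * qhyp [?a, g] [?c] q (q * inverse g * cis (- 2 * \<theta>))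
     = (\<Sum>k\<le>n. qfac g n / qfac q n * cis (real n * \<theta>) * T k)"
    by (simp add: qpoch_eq sum_distrib_left)
  also have "\<dots> = (\<Sum>k\<le>n. qbin 1 g k * qbin 1 g (n - k) * cis (of_int (2 * int k - int n) * (- \<theta>)))"
  proof (intro sum.cong refl)
    fix k assume "k \<in> {..n}"
    then have k: "k \<le> n" by simp
    have "cis (real n * \<theta>) * cis (- 2 * \<theta>) ^ k = cis (of_int (2 * int k - int n) * (- \<theta>))"
      unfolding Complex.DeMoivre cis_mult by (rule arg_cong[of _ _ cis]) (simp add: algebra_simps)
    moreover have "qfac g n / qfac q n * cis (real n * \<theta>) * T k
       = qfac g n / qfac q n * (qfac ?a k / qfac ?c k * (q * inverse g) ^ k) * (qfac g k / qfac q k)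
          * (cis (real n * \<theta>) * cis (- 2 * \<theta>) ^ k)"
      by (simp add: T_def power_mult_distrib mult_ac)
    ultimately show "qfac g n / qfac q n * cis (real n * \<theta>) * T k
       = qbin 1 g k * qbin 1 g (n - k) * cis (of_int (2 * int k - int n) * (- \<theta>))"
      unfolding qfac_reversed[OF assms k] qbin_one by (simp add: mult_ac)
  qed
  also have "\<dots> = rogers g n (cis (- \<theta>))"
    by (rule rogers_cis[symmetric])
  also have "\<dots> = rogers g n (cis \<theta>)"
    using rogers_inverse[of g n "cis \<theta>"] by (simp add: cis_inverse)
  finally show ?thesis .
qed

definition rogers_gen :: "complex \<Rightarrow> complex \<Rightarrow> real \<Rightarrow> complex" where
  "rogers_gen a t \<theta> = 1 / qpoch_inf [t * cis \<theta>] q * qhyp [a, a * cis (2 * \<theta>)] [a\<^sup>2] q (t * cis (- \<theta>))"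

lemma rogers_gen_sums:
  assumes "norm a < 1" "q \<noteq> 0" "norm t < 1"
  shows "(\<lambda>n. rogers a n (cis \<theta>) / qfac (a\<^sup>2) n * t ^ n) sums rogers_gen a t \<theta>"
proof -
  have "qhyp [a, a * cis (2 * \<theta>)] [a\<^sup>2] q (t * cis (- \<theta>)) = (\<Sum>k. ecoef a (cis \<theta>) k * t ^ k)"
    unfolding qhyp_def qpoch_eq ecoef_def
    by (simp add: cis_inverse power_mult_distrib Complex.DeMoivre mult_ac)
  then show ?thesis
    using rogers_generating_function[OF assms(1) norm_cis assms(2,3)]
    by (simp add: rogers_gen_def qpoch_inf_def)
qed

end

context rogers_parameter
begin

lemma weight_eq:
  assumes "cnj q = q" "cnj g = g"
  shows "weight \<theta> = of_real ((cmod (qpoch_inf [cis (2 * \<theta>)] q / qpoch_inf [g * cis (2 * \<theta>)] q))\<^sup>2)"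
proof -
  have r: "rser (cis x) = qpoch_inf [cis x] q / qpoch_inf [g * cis x] q" for x
    unfolding rser_def rcoef_def using q_binomial_theorem[of g "cis x" 1] norm_g
    by (simp add: norm_mult qpoch_inf_def sums_unique[symmetric])
  have "cnj (rcoef k) = rcoef k" for k
    by (simp add: rcoef_def qbin_def qfac_def assms)
  moreover have "summable (\<lambda>k. rcoef k * cis x ^ k)" for x
    by (rule summable_norm_cancel) (simp add: norm_mult norm_power summable_norm_rcoef)
  then have "(\<lambda>k. rcoef k * cis x ^ k) sums rser (cis x)" for x
    unfolding rser_def by (rule summable_sums)
  then have "(\<lambda>k. cnj (rcoef k * cis x ^ k)) sums cnj (rser (cis x))" for x
    by (subst sums_cnj)
  ultimately have "cnj (rser (cis x)) = rser (cis (- x))" for x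
    unfolding rser_def[of "cis (- x)"] by (simp add: cis_cnj sums_unique)
  then have "weight \<theta> = rser (cis (2 * \<theta>)) * cnj (rser (cis (2 * \<theta>)))"
    by (simp add: weight_def)
  then show ?thesis
    by (simp only: r complex_norm_square)
qed

lemma weight_int_rogers_gen:
  assumes "norm b < 1" "q \<noteq> 0" "norm t < 1"
  shows "continuous_on {-pi..pi} (\<lambda>x. rogers_gen b t x * rogers g n (cis x) * weight x)"
    and "(\<lambda>m. mixed_moment b m n / qfac (b\<^sup>2) m * t ^ m) sums weight_int (\<lambda>x. rogers_gen b t x * rogers g n (cis x))"
proof -
  define f where "f m x = rogers b m (cis x) / qfac (b\<^sup>2) m * t ^ m * (rogers g n (cis x) * weight x)" for m x
  have cont: "continuous_on {-pi..pi} (\<lambda>x. rogers g n (cis x) * weight x)"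
    by (intro continuous_intros continuous_on_weight)
  obtain B where B: "\<And>x. x \<in> {-pi..pi} \<Longrightarrow> norm (rogers g n (cis x) * weight x) \<le> B"
    using compact_imp_bounded[OF compact_continuous_image[OF cont compact_Icc]]
    by (force simp: bounded_iff)
  obtain M where M: "summable M" "\<And>m z. norm z = 1 \<Longrightarrow> norm (rogers b m z / qfac (b\<^sup>2) m * t ^ m) \<le> M m"
    using rogers_generating_function_majorant[OF assms] by metis
  have fc: "continuous_on {-pi..pi} (f m)" for m
    unfolding f_def divide_inverse by (intro continuous_intros continuous_on_weight)
  have fb: "norm (f m x) \<le> M m * B" if "x \<in> {-pi..pi}" for m x
  proof -
    have "0 \<le> M m" using M(2)[of 1 m] by (meson norm_ge_zero norm_one order_trans)
    then show ?thesis
      unfolding f_def norm_mult[of "rogers b m (cis x) / qfac (b\<^sup>2) m * t ^ m"]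
      using M(2)[OF norm_cis] B[OF that] by (intro mult_mono) auto
  qed
  note * = uniform_series_integral[of "-pi" pi f, OF fc fb summable_mult2[OF M(1)]]
  have sum: "(\<Sum>m. f m x) = rogers_gen b t x * rogers g n (cis x) * weight x" for x
    using sums_unique[OF sums_mult2[OF rogers_gen_sums[OF assms], of x "rogers g n (cis x) * weight x"]]
    by (simp add: f_def mult.assoc)
  show "continuous_on {-pi..pi} (\<lambda>x. rogers_gen b t x * rogers g n (cis x) * weight x)"
    using *(1) unfolding sum .
  have "integral {-pi..pi} (f m) = mixed_moment b m n / qfac (b\<^sup>2) m * t ^ m" for m
  proof -
    have "f m = (\<lambda>x. (t ^ m / qfac (b\<^sup>2) m) * (rogers b m (cis x) * rogers g n (cis x) * weight x))"
      by (simp add: f_def fun_eq_iff)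
    then show ?thesis
      by (simp only: integral_mult_right mixed_moment_def weight_int_def) simp
  qed
  then show "(\<lambda>m. mixed_moment b m n / qfac (b\<^sup>2) m * t ^ m) sums weight_int (\<lambda>x. rogers_gen b t x * rogers g n (cis x))"
    using *(2) unfolding sum weight_int_def by simp
qed

lemma mixed_moment_val_eq:
  assumes "norm b < 1" "g \<noteq> 0" "x\<^sup>2 = b\<^sup>2 * q ^ n" "y\<^sup>2 = b\<^sup>2 * q ^ (n + 1)"
  shows "mixed_moment_val b n k / qfac (b\<^sup>2) (n + 2 * k) * t ^ (n + 2 * k)
    = 4 * of_real pi * t ^ n * (qpoch_inf [g, q * g] q * qpoch [b, g\<^sup>2] q n) /
            (qpoch_inf [g\<^sup>2, q] q * qpoch [q, b\<^sup>2, q * g] q n) *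
      (qpoch [b / g, b * q ^ n, 0, 0, 0, 0] q k / qpoch [q, g * q ^ (n + 1), x, - x, y, - y] q k * (g * t\<^sup>2) ^ k)"
proof -
  have 1: "(\<Prod>i<k. g - b * q ^ i) = g ^ k * qfac (b / g) k"
    using assms(2) by (induction k) (simp_all add: qfac_Suc field_simps)
  have 2: "qfac 0 k = 1" by (simp add: qfac_def)
  have 3: "qfac (b\<^sup>2) (n + 2 * k) = qfac (b\<^sup>2) n * (qfac x k * qfac (- x) k * qfac y k * qfac (- y) k)"
    unfolding qfac_add using assms(3,4) by (subst qfac_double[of x _ y]) (simp_all add: mult_ac)
  have 4: "qfac (q * g) (n + k) = qfac (q * g) n * qfac (g * q ^ (n + 1)) k"
    unfolding qfac_add by (simp add: mult_ac)
  have 5: "t ^ (n + 2 * k) = t ^ n * (t\<^sup>2) ^ k"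
    by (simp add: power_add power_mult)
  show ?thesis
    unfolding mixed_moment_val_def hcoef_0_eq 1 3 4 5 qfac_add[of b] qpoch_eq qpoch_inf_def
    by (simp add: 2 power_mult_distrib mult_ac)
qed

text \<open>Only \<open>m = n + 2 k\<close> contributes to the expansion in mixed moments. The parameters \<open>x\<close> and \<open>y\<close> are
  any square roots of \<open>b\<^sup>2 q\<^sup>n\<close> and \<open>b\<^sup>2 q\<^bsup>n + 1\<^esup>\<close>, since only their squares enter.\<close>

lemma integral_rogers_gen:
  assumes "norm b < 1" "g \<noteq> 0" "q \<noteq> 0" "norm t < 1" "x\<^sup>2 = b\<^sup>2 * q ^ n" "y\<^sup>2 = b\<^sup>2 * q ^ (n + 1)"
  shows "integral {0..pi} (\<lambda>\<theta>. rogers_gen b t \<theta> * rogers g n (cis \<theta>) * weight \<theta>)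
     = 2 * of_real pi * t ^ n * (qpoch_inf [g, q * g] q * qpoch [b, g\<^sup>2] q n) /
            (qpoch_inf [g\<^sup>2, q] q * qpoch [q, b\<^sup>2, q * g] q n) *
       qhyp [b / g, b * q ^ n, 0, 0, 0, 0] [g * q ^ (n + 1), x, - x, y, - y] q (g * t\<^sup>2)"
proof -
  define W where "W = weight_int (\<lambda>x. rogers_gen b t x * rogers g n (cis x))"
  define K where "K = 2 * of_real pi * t ^ n * (qpoch_inf [g, q * g] q * qpoch [b, g\<^sup>2] q n) /
            (qpoch_inf [g\<^sup>2, q] q * qpoch [q, b\<^sup>2, q * g] q n)"
  define T where "T k = qpoch [b / g, b * q ^ n, 0, 0, 0, 0] q k / qpoch [q, g * q ^ (n + 1), x, - x, y, - y] q k * (g * t\<^sup>2) ^ k" for k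
  have "(\<lambda>m. mixed_moment b m n / qfac (b\<^sup>2) m * t ^ m) sums W"
    unfolding W_def by (rule weight_int_rogers_gen(2)[OF assms(1,3,4)])
  moreover have "mixed_moment b m n = 0" if "m \<notin> range (\<lambda>k. n + 2 * k)" for m
  proof -
    have "\<not> (n \<le> m \<and> even (m - n))"
    proof
      assume *: "n \<le> m \<and> even (m - n)"
      then obtain k where "m - n = 2 * k" by (meson evenE)
      with * have "m = n + 2 * k" by simp
      with that show False by blast
    qed
    then show ?thesis unfolding mixed_moment_eq by (rule if_not_P)
  qed
  ultimately have "(\<lambda>k. mixed_moment b (n + 2 * k) n / qfac (b\<^sup>2) (n + 2 * k) * t ^ (n + 2 * k)) sums W"
    by (subst sums_mono_reindex[of "\<lambda>k. n + 2 * k" "\<lambda>m. mixed_moment b m n / qfac (b\<^sup>2) m * t ^ m"])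
      (auto simp: strict_mono_def)
  then have "(\<lambda>k. (2 * K) * T k) sums W"
    unfolding mixed_moment_eq K_def T_def using mixed_moment_val_eq[OF assms(1,2,5,6)] by (simp add: mult_ac)
  then have "W = (2 * K) * (\<Sum>k. T k)"
    by (cases "K = 0") (auto simp: sums_iff suminf_mult summable_mult_D)
  also have "(\<Sum>k. T k) = qhyp [b / g, b * q ^ n, 0, 0, 0, 0] [g * q ^ (n + 1), x, - x, y, - y] q (g * t\<^sup>2)"
    by (simp add: qhyp_def T_def)
  finally have W: "W = 2 * K * qhyp [b / g, b * q ^ n, 0, 0, 0, 0] [g * q ^ (n + 1), x, - x, y, - y] q (g * t\<^sup>2)" .
  have "rogers_gen b t (- \<theta>) = rogers_gen b t \<theta>" for \<theta>
    using rogers_gen_sums[OF assms(1,3,4), of \<theta>] rogers_gen_sums[OF assms(1,3,4), of "- \<theta>"]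
      rogers_inverse[of b _ "cis \<theta>"] by (simp add: cis_inverse sums_unique2)
  then have "W = 2 * integral {0..pi} (\<lambda>\<theta>. rogers_gen b t \<theta> * rogers g n (cis \<theta>) * weight \<theta>)"
    unfolding W_def weight_int_def using weight_int_rogers_gen(1)[OF assms(1,3,4)]
      rogers_inverse[of g n "cis \<theta>" for \<theta>] by (intro integral_even_half) (simp_all add: cis_inverse weight_even)
  with W have "2 * integral {0..pi} (\<lambda>\<theta>. rogers_gen b t \<theta> * rogers g n (cis \<theta>) * weight \<theta>)
    = 2 * (K * qhyp [b / g, b * q ^ n, 0, 0, 0, 0] [g * q ^ (n + 1), x, - x, y, - y] q (g * t\<^sup>2))"
    by (simp only: mult.assoc)
  then have "integral {0..pi} (\<lambda>\<theta>. rogers_gen b t \<theta> * rogers g n (cis \<theta>) * weight \<theta>)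
    = K * qhyp [b / g, b * q ^ n, 0, 0, 0, 0] [g * q ^ (n + 1), x, - x, y, - y] q (g * t\<^sup>2)"
    by (subst (asm) mult_left_cancel) simp_all
  then show ?thesis
    unfolding K_def .
qed

end

theorem corollary19:
  fixes n :: nat and \<beta> \<gamma> q :: real and t :: complex
  defines "b \<equiv> complex_of_real \<beta>" and "g \<equiv> complex_of_real \<gamma>" and "p \<equiv> complex_of_real q"
  assumes "\<beta> \<in> {-1<..<1} - {0}" and "\<gamma> \<in> {-1<..<1} - {0}"
    and "0 < \<bar>q\<bar>" and "\<bar>q\<bar> < 1"
    and "cmod t < 1 - \<beta>\<^sup>2"
  shows "((\<lambda>x. let \<theta> = arccos x in
            1 / qpoch_inf [t * cis \<theta>] p *
            qhyp [b, b * cis (2 * \<theta>)] [b\<^sup>2] p (t * cis (- \<theta>)) *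
            rogers_poly n \<gamma> q x *
            complex_of_real (rogers_weight \<gamma> q x / sqrt (1 - x\<^sup>2)))
          has_integral
            2 * complex_of_real pi * t ^ n *
            (qpoch_inf [g, p * g] p * qpoch [b, g\<^sup>2] p n) /
            (qpoch_inf [g\<^sup>2, p] p * qpoch [p, b\<^sup>2, p * g] p n) *
            qhyp [b / g, b * p ^ n, 0, 0, 0, 0]
              [g * p ^ (n + 1),
               b * p powr (of_nat n / 2), - (b * p powr (of_nat n / 2)),
               b * p powr (of_nat (n + 1) / 2), - (b * p powr (of_nat (n + 1) / 2))]
              p (g * t\<^sup>2))
         {-1<..<1}"
proof -
  have p: "norm p < 1" "p \<noteq> 0" "cnj p = p" and g: "norm g < 1" "g \<noteq> 0" "cnj g = g" and b: "norm b < 1"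
    using assms(4-7) by (auto simp: p_def g_def b_def)
  have t: "norm t < 1" using assms(8) by (smt (verit) zero_le_power2)
  interpret rogers_parameter p g
    by unfold_locales (use p g in auto)
  have powr: "(b * p powr (of_nat m / 2))\<^sup>2 = b\<^sup>2 * p ^ m" for m
  proof -
    have "(p powr (of_nat m / 2))\<^sup>2 = p powr (of_nat m / 2 + of_nat m / 2)"
      unfolding power2_eq_square by (rule powr_add[symmetric])
    also have "\<dots> = p ^ m" using p(2) by (simp add: powr_nat')
    finally show ?thesis by (simp add: power_mult_distrib)
  qed
  define f where "f \<theta> = rogers_gen b t \<theta> * rogers g n (cis \<theta>) * weight \<theta>" for \<theta>
  have "continuous_on {0..pi} f"
    unfolding f_def by (rule continuous_on_subset[OF weight_int_rogers_gen(1)[OF b p(2) t]]) auto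
  note * = has_integral_arccos_substitution[OF this]
  have eq: "f (arccos x) * of_real (1 / sqrt (1 - x\<^sup>2)) = (let \<theta> = arccos x in
            1 / qpoch_inf [t * cis \<theta>] p *
            qhyp [b, b * cis (2 * \<theta>)] [b\<^sup>2] p (t * cis (- \<theta>)) *
            rogers_poly n \<gamma> q x *
            complex_of_real (rogers_weight \<gamma> q x / sqrt (1 - x\<^sup>2)))" for x
  proof -
    have "rogers_poly n \<gamma> q x = rogers g n (cis (arccos x))"
      unfolding rogers_poly_def Let_def p_def[symmetric] g_def[symmetric]
      by (rule rogers_eq_qhyp[OF g(1,2) p(2)])
    moreover have "of_real (rogers_weight \<gamma> q x) = weight (arccos x)"
      unfolding weight_eq[OF p(3) g(3)] unfolding rogers_weight_def Let_def p_def g_def ..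
    ultimately show ?thesis
      by (simp add: f_def rogers_gen_def Let_def)
  qed
  show ?thesis
    using * unfolding eq unfolding f_def[abs_def] integral_rogers_gen[OF b g(2) p(2) t powr powr] .
qed

end
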